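(* Let $G$ be a locally compact, compactly generated group, $\Gamma$ a cocompact lattice in $G$, and $\Lambda\le\mathrm{Comm}_G(\Gamma)$ a dense subgroup of $G$ containing $\Gamma$. Let $X$ be a complete uniformly convex BNPC metric space on which $\Lambda$ acts by isometries; assume that the action is $C$-minimal and that every subgroup of $\Lambda$ commensurable to $\Gamma$ has displacement going to infinity and has no parallel orbits. Then for every subgroup $\Gamma_0\le\Lambda$ commensurable to $\Gamma$ there exists a $\Gamma_0$-harmonic map.
   Context: $\mathrm{Comm}_G(\Gamma)=\{g\in G: g\Gamma g^{-1}\text{ and }\Gamma\text{ are commensurable}\}$. BNPC: a complete geodesic metric space in which the distance between any two constant speed geodesics is a convex function (hence uniquely geodesic, with midpoints $\frac{x+y}{2}$). Uniformly convex: $d(x,\frac{y_1+y_2}{2})<\max\{d(x,y_1),d(x,y_2)\}$ whenever $y_1\neq y_2$, and for every $\epsilon>0$ there is $\delta(\epsilon)>0$ such that for all $r>0$, $x\in X$: $\inf\{r-d(x,\frac{y_1+y_2}{2}): d(x,y_i)\le r,\ d(y_1,y_2)\ge\epsilon r\}\ge\delta(\epsilon) r$. Displacement going to infinity for $\Gamma_0$: $d_{\Sigma_0}(x)=\max_{\sigma\in\Sigma_0}d(\sigma x,x)\to\infty$ as $x$ leaves every ball, where $\Sigma_0$ is a finite generating set of $\Gamma_0$. Segments $[a,b],[x,y]$ are parallel if $d(a,x)=d(b,y)=d(\frac{a+b}{2},\frac{x+y}{2})$. $\Gamma_0$ has no parallel orbits if for any distinct $x,y\in X$ there is $\gamma\in\Gamma_0$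 such that $[\gamma x,\gamma y]$ and $[x,y]$ are not parallel. $C$-minimal: no non-empty closed convex proper invariant subset. For $\Gamma_0\le\Lambda$ commensurable to $\Gamma$, let $\Omega_0$ be a relatively compact (right) fundamental domain for $\Gamma_0$ in $G$ ($G=\bigsqcup_{\gamma\in\Gamma_0}\gamma\Omega_0$), $\mu$ Haar measure on $G$. $L_2(\Omega_0,X)$ is the space of measurable $\Gamma_0$-equivariant maps $\varphi:G\to X$ (modulo null sets) with $\int_{\Omega_0}d(\varphi(\omega),x_0)^2<\infty$. Let $h:G\to\mathbb{R}_{>0}$ be $h(g)=e^{-|g|_K^2+1}$, where $|g|_K=\min\{k:g\in K^k\}$ for a fixed compact generating set $K$ of $G$. Put $$I_{\Gamma_0}(\varphi)=\frac{1}{\mu(\Omega_0)}\int_{\Omega_0\times G}h(\omega^{-1}g)\,d(\varphi(\omega),\varphi(g))^2.$$ A $\Gamma_0$-harmonic map is an element of $L_2(\Omega_0,X)$ minimizing $I_{\Gamma_0}$ over $L_2(\Omega_0,X)$. *)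

theory Defs
  imports "HOL-Analysis.Analysis"
begin

text \<open>
  Groups are written additively: the class \<^class>\<open>topological_group_add\<close> is the library's class of
  topological groups, and \<^class>\<open>group_add\<close> does not assume commutativity. Thus \<open>g + h\<close>, \<open>- g\<close>
  and \<open>0\<close> stand for $gh$, $g^{-1}$ and $e$.
\<close>

subsection \<open>Subgroups, commensurability, lattices\<close>

definition is_subgroup :: "'g::group_add set \<Rightarrow> bool" where
  "is_subgroup H \<longleftrightarrow> 0 \<in> H \<and> (\<forall>a\<in>H. \<forall>b\<in>H. a + b \<in> H) \<and> (\<forall>a\<in>H. - a \<in> H)"

text \<open>The set counted here is the set of cosets \<open>k + H\<close> with \<open>k \<in> K\<close>.\<close>

definition finite_index :: "'g::group_add set \<Rightarrow> 'g set \<Rightarrow> bool" where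
  "finite_index H K \<longleftrightarrow> finite ((\<lambda>k. (+) k ` H) ` K)"

definition commensurable :: "'g::group_add set \<Rightarrow> 'g set \<Rightarrow> bool" where
  "commensurable A B \<longleftrightarrow> finite_index (A \<inter> B) A \<and> finite_index (A \<inter> B) B"

definition commensurator :: "'g::group_add set \<Rightarrow> 'g set" where
  "commensurator \<Gamma> = {g. commensurable ((\<lambda>\<gamma>. g + \<gamma> - g) ` \<Gamma>) \<Gamma>}"

text \<open>
  A cocompact (uniform) lattice is a discrete subgroup whose space of cosets \<open>\<Gamma> + g\<close> is compact for
  the quotient topology, which is the unique topology making the projection a quotient map.
  Finiteness of the covolume is automatic for such subgroups.
\<close>

definition cocompact_lattice :: "'g::topological_group_add set \<Rightarrow> bool" where
  "cocompact_lattice \<Gamma> \<longleftrightarrow> is_subgroup \<Gamma>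
     \<and> subtopology euclidean \<Gamma> = discrete_topology \<Gamma>
     \<and> (\<exists>T. quotient_map euclidean T (\<lambda>g. (\<lambda>\<gamma>. \<gamma> + g) ` \<Gamma>) \<and> compact_space T)"

primrec set_power :: "'g::group_add set \<Rightarrow> nat \<Rightarrow> 'g set" where
  "set_power K 0 = {0}"
| "set_power K (Suc n) = {a + b | a b. a \<in> set_power K n \<and> b \<in> K}"

text \<open>Every element is required to lie in some power of \<open>K\<close> (automatic if \<open>K\<close> is symmetric and
  generates as a group); this is what makes the length function below defined everywhere.\<close>

definition compact_generating_set :: "'g::topological_group_add set \<Rightarrow> bool" where
  "compact_generating_set K \<longleftrightarrow> compact K \<and> (\<Union>n. set_power K n) = UNIV"

definition word_length :: "'g::group_add set \<Rightarrow> 'g \<Rightarrow> nat" where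
  "word_length K g = (LEAST n. g \<in> set_power K n)"

text \<open>Left Haar measures, as Radon measures on the Borel sigma-algebra. (A group containing a
  lattice is unimodular, so left and right Haar measures agree in the situation of interest.)\<close>

definition haar_measure :: "'g::topological_group_add measure \<Rightarrow> bool" where
  "haar_measure \<mu> \<longleftrightarrow> sets \<mu> = sets borel
     \<and> emeasure \<mu> UNIV \<noteq> 0
     \<and> (\<forall>g. \<forall>A\<in>sets borel. emeasure \<mu> ((+) g ` A) = emeasure \<mu> A)
     \<and> (\<forall>C. compact C \<longrightarrow> emeasure \<mu> C < \<infinity>)
     \<and> (\<forall>A\<in>sets borel. emeasure \<mu> A = (INF U\<in>{U. open U \<and> A \<subseteq> U}. emeasure \<mu> U))
     \<and> (\<forall>U. open U \<longrightarrow> emeasure \<mu> U = (SUP C\<in>{C. compact C \<and> C \<subseteq> U}. emeasure \<mu> C))"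

definition rel_compact_fundamental_domain :: "'g::topological_group_add set \<Rightarrow> 'g set \<Rightarrow> bool" where
  "rel_compact_fundamental_domain \<Gamma> \<Omega> \<longleftrightarrow> \<Omega> \<in> sets borel \<and> compact (closure \<Omega>)
     \<and> (\<Union>\<gamma>\<in>\<Gamma>. (+) \<gamma> ` \<Omega>) = UNIV \<and> disjoint_family_on (\<lambda>\<gamma>. (+) \<gamma> ` \<Omega>) \<Gamma>"

subsection \<open>Geodesic spaces\<close>

text \<open>Constant speed minimizing geodesics, parametrized by the unit interval.\<close>

definition geodesic :: "(real \<Rightarrow> 'x::metric_space) \<Rightarrow> bool" where
  "geodesic c \<longleftrightarrow> (\<forall>s\<in>{0..1}. \<forall>t\<in>{0..1}. dist (c s) (c t) = dist (c 0) (c 1) * \<bar>s - t\<bar>)"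

definition bnpc :: "'x::complete_space itself \<Rightarrow> bool" where
  "bnpc _ \<longleftrightarrow> (\<forall>x y :: 'x. \<exists>c. geodesic c \<and> c 0 = x \<and> c 1 = y)
     \<and> (\<forall>c c' :: real \<Rightarrow> 'x. geodesic c \<and> geodesic c' \<longrightarrow> convex_on {0..1} (\<lambda>t. dist (c t) (c' t)))"

text \<open>Well defined in BNPC spaces, which are uniquely geodesic.\<close>

definition geo_midpoint :: "'x::metric_space \<Rightarrow> 'x \<Rightarrow> 'x" where
  "geo_midpoint x y = (THE m. \<exists>c. geodesic c \<and> c 0 = x \<and> c 1 = y \<and> m = c (1/2))"

text \<open>The second clause unfolds the condition that the infimum of \<open>r - dist x (geo_midpoint y1 y2)\<close>
  over all admissible \<open>y1\<close>, \<open>y2\<close> is at least \<open>\<delta> * r\<close> (the infimum of the empty set being infinite).\<close>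

definition uniformly_convex :: "'x::metric_space itself \<Rightarrow> bool" where
  "uniformly_convex _ \<longleftrightarrow>
     (\<forall>x y1 y2 :: 'x. y1 \<noteq> y2 \<longrightarrow> dist x (geo_midpoint y1 y2) < max (dist x y1) (dist x y2))
   \<and> (\<forall>\<epsilon>>0. \<exists>\<delta>>0. \<forall>r>0. \<forall>x y1 y2 :: 'x.
        dist x y1 \<le> r \<and> dist x y2 \<le> r \<and> dist y1 y2 \<ge> \<epsilon> * r
        \<longrightarrow> r - dist x (geo_midpoint y1 y2) \<ge> \<delta> * r)"

definition geodesically_convex :: "'x::metric_space set \<Rightarrow> bool" where
  "geodesically_convex C \<longleftrightarrow> (\<forall>c. geodesic c \<and> c 0 \<in> C \<and> c 1 \<in> C \<longrightarrow> c ` {0..1} \<subseteq> C)"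

definition parallel_segments :: "'x::metric_space \<Rightarrow> 'x \<Rightarrow> 'x \<Rightarrow> 'x \<Rightarrow> bool" where
  "parallel_segments a b x y \<longleftrightarrow>
     dist a x = dist b y \<and> dist b y = dist (geo_midpoint a b) (geo_midpoint x y)"

subsection \<open>Isometric actions\<close>

definition isometric_action :: "'g::group_add set \<Rightarrow> ('g \<Rightarrow> 'x::metric_space \<Rightarrow> 'x) \<Rightarrow> bool" where
  "isometric_action \<Lambda> act \<longleftrightarrow> (\<forall>x. act 0 x = x)
     \<and> (\<forall>a\<in>\<Lambda>. \<forall>b\<in>\<Lambda>. \<forall>x. act (a + b) x = act a (act b x))
     \<and> (\<forall>a\<in>\<Lambda>. \<forall>x y. dist (act a x) (act a y) = dist x y)"

definition C_minimal :: "'g set \<Rightarrow> ('g \<Rightarrow> 'x::metric_space \<Rightarrow> 'x) \<Rightarrow> bool" where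
  "C_minimal \<Lambda> act \<longleftrightarrow>
     \<not> (\<exists>C. C \<noteq> {} \<and> closed C \<and> geodesically_convex C \<and> C \<noteq> UNIV \<and> (\<forall>a\<in>\<Lambda>. act a ` C \<subseteq> C))"

text \<open>Inserting \<open>0\<close> only matters for \<open>S = {}\<close>, where the maximum would be unspecified.\<close>

definition displacement :: "('g \<Rightarrow> 'x::metric_space \<Rightarrow> 'x) \<Rightarrow> 'g set \<Rightarrow> 'x \<Rightarrow> real" where
  "displacement act S x = Max (insert 0 ((\<lambda>\<sigma>. dist (act \<sigma> x) x) ` S))"

text \<open>By the triangle inequality the choice of the finite generating set is immaterial.\<close>

definition displacement_to_infinity ::
    "('g::group_add \<Rightarrow> 'x::metric_space \<Rightarrow> 'x) \<Rightarrow> 'g set \<Rightarrow> bool" where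
  "displacement_to_infinity act \<Gamma> \<longleftrightarrow>
     (\<exists>S. finite S \<and> is_subgroup hull S = \<Gamma> \<and>
        (\<forall>M. \<exists>a R. \<forall>x. x \<notin> cball a R \<longrightarrow> displacement act S x \<ge> M))"

definition no_parallel_orbits :: "('g \<Rightarrow> 'x::metric_space \<Rightarrow> 'x) \<Rightarrow> 'g set \<Rightarrow> bool" where
  "no_parallel_orbits act \<Gamma> \<longleftrightarrow>
     (\<forall>x y. x \<noteq> y \<longrightarrow> (\<exists>\<gamma>\<in>\<Gamma>. \<not> parallel_segments (act \<gamma> x) (act \<gamma> y) x y))"

subsection \<open>Square integrable equivariant maps and harmonicity\<close>

text \<open>
  Measurability of a map into a possibly non-separable metric space is understood in the usual strong
  sense: Borel measurable and almost everywhere with values in a separable set. (Otherwise the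
  distance between two measurable maps need not be measurable.) Classes modulo null sets are
  represented by genuine functions.
\<close>

definition L2_equivariant ::
    "('g::topological_group_add \<Rightarrow> 'x::metric_space \<Rightarrow> 'x) \<Rightarrow> 'g set \<Rightarrow> 'g measure \<Rightarrow> 'g set \<Rightarrow> 'x
      \<Rightarrow> ('g \<Rightarrow> 'x) set" where
  "L2_equivariant act \<Gamma> \<mu> \<Omega> x0 = {\<phi>. \<phi> \<in> borel_measurable \<mu>
     \<and> (\<exists>D. countable D \<and> (AE g in \<mu>. \<phi> g \<in> closure D))
     \<and> (\<forall>\<gamma>\<in>\<Gamma>. \<forall>g. \<phi> (\<gamma> + g) = act \<gamma> (\<phi> g))
     \<and> (\<integral>\<^sup>+\<omega>\<in>\<Omega>. ennreal ((dist (\<phi> \<omega>) x0)\<^sup>2) \<partial>\<mu>) < \<infinity>}"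

definition energy_weight :: "'g::group_add set \<Rightarrow> 'g \<Rightarrow> real" where
  "energy_weight K g = exp (- (real (word_length K g))\<^sup>2 + 1)"

text \<open>
  The energy takes values in the extended nonnegative reals. The double integral over \<open>\<Omega> \<times> G\<close> is
  written as an iterated one, since without second countability of the group the product of the
  Borel sigma-algebras is smaller than the Borel sigma-algebra of the product.
\<close>

definition energy ::
    "'g::topological_group_add set \<Rightarrow> 'g measure \<Rightarrow> 'g set \<Rightarrow> ('g \<Rightarrow> 'x::metric_space) \<Rightarrow> ennreal" where
  "energy K \<mu> \<Omega> \<phi> =
     (\<integral>\<^sup>+\<omega>\<in>\<Omega>. (\<integral>\<^sup>+g. ennreal (energy_weight K (- \<omega> + g) * (dist (\<phi> \<omega>) (\<phi> g))\<^sup>2) \<partial>\<mu>) \<partial>\<mu>)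
       / emeasure \<mu> \<Omega>"

definition harmonic_map ::
    "('g::topological_group_add \<Rightarrow> 'x::metric_space \<Rightarrow> 'x) \<Rightarrow> 'g set \<Rightarrow> 'g set \<Rightarrow> 'g measure \<Rightarrow> 'g set \<Rightarrow> 'x
      \<Rightarrow> ('g \<Rightarrow> 'x) \<Rightarrow> bool" where
  "harmonic_map act K \<Gamma> \<mu> \<Omega> x0 \<phi> \<longleftrightarrow> \<phi> \<in> L2_equivariant act \<Gamma> \<mu> \<Omega> x0
     \<and> (\<forall>\<psi>\<in>L2_equivariant act \<Gamma> \<mu> \<Omega> x0. energy K \<mu> \<Omega> \<phi> \<le> energy K \<mu> \<Omega> \<psi>)"

end

theory Submission
  imports Defs "HOL-Probability.Giry_Monad"
begin

text \<open>
  The harmonic map is found by the direct method of the calculus of variations. The energy is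
  convex, because in a BNPC space the distance between two midpoints is at most the mean of the
  distances of the endpoints, and by Fatou's lemma it is lower semicontinuous. It remains to see that a
  suitable minimizing sequence converges in the mean square sense; this needs boundedness
  and a substitute for weak compactness.

  Boundedness comes from the displacement. For \<open>\<sigma>\<close> in a finite generating set, \<open>w\<close> and \<open>\<sigma> + w\<close> interact
  with a common compact set of points with weights bounded from below, so the energy density at \<open>w\<close>
  dominates the square of the displacement of \<open>\<phi> w\<close>
  (\<open>displacement_le_inner_energy\<close>). The displacement is convex along
  geodesics and tends to infinity, hence grows at least linearly (\<open>displacement_linear_growth\<close>).
  So the energy controls the square norm of a map (\<open>sq_norm_le_total_energy\<close>).

  Uniform convexity replaces weak compactness. Its pointwise form
  \<open>uniformly_convex_square_defect\<close> is linear in squared distances and can be integrated over the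
  fundamental domain. Among maps with almost minimal energy one selects maps with almost minimal norm;
  midpoints of such maps have almost minimal energy too, so their norm cannot be much smaller, and uniform
  convexity shows that the selected sequence is Cauchy
  (\<open>minimizing_sequence_small_defect\<close>, \<open>total_energy_minimizer\<close>).

  Neither the group nor the space need be second countable, which makes measurability delicate. Every
  square integrable map is replaced by an almost everywhere equal one that is separably valued at all
  points (\<open>L2_equivalent_separable\<close>). The energy density is measurable although its integrand
  need not be measurable for the product sigma-algebra, because the Haar measure of
  a moving compact set depends upper semicontinuously on the translation
  (\<open>borel_measurable_haar_compact_translate\<close>, \<open>borel_measurable_weighted_haar_integral\<close>). The bound on
  the weights requires that the word length is bounded on compact sets, which is a consequence of the
  Baire category theorem (\<open>word_length_bounded_on_compact\<close>).
\<close>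

section \<open>Midpoints in BNPC spaces\<close>

lemma geodesic_const: "geodesic (\<lambda>_. x)"
  by (simp add: geodesic_def)

lemma bnpc_geodesic_exists:
  fixes x y :: "'x::complete_space"
  assumes "bnpc TYPE('x)"
  obtains c :: "real \<Rightarrow> 'x" where "geodesic c" "c 0 = x" "c 1 = y"
  using assms unfolding bnpc_def by meson

lemma bnpc_convex_dist:
  fixes c c' :: "real \<Rightarrow> 'x::complete_space"
  assumes "bnpc TYPE('x)" "geodesic c" "geodesic c'" "t \<in> {0..1}"
  shows "dist (c t) (c' t) \<le> (1 - t) * dist (c 0) (c' 0) + t * dist (c 1) (c' 1)"
proof -
  have "convex_on {0..1} (\<lambda>t. dist (c t) (c' t))"
    using assms unfolding bnpc_def by blast
  from convex_onD[OF this, of t 0 1] show ?thesis using assms(4) by simp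
qed

text \<open>The midpoint is well defined: the distance between two geodesics with common endpoints is
  convex and vanishes at both ends.\<close>

lemma geo_midpoint_eq:
  fixes c :: "real \<Rightarrow> 'x::complete_space"
  assumes "bnpc TYPE('x)" "geodesic c"
  shows "geo_midpoint (c 0) (c 1) = c (1/2)"
  unfolding geo_midpoint_def
proof (rule the_equality)
  show "\<exists>c'. geodesic c' \<and> c' 0 = c 0 \<and> c' 1 = c 1 \<and> c (1/2) = c' (1/2)"
    using assms by blast
next
  fix m assume "\<exists>c'. geodesic c' \<and> c' 0 = c 0 \<and> c' 1 = c 1 \<and> m = c' (1/2)"
  then obtain c' where c': "geodesic c'" "c' 0 = c 0" "c' 1 = c 1" "m = c' (1/2)" by blast
  show "m = c (1/2)"
    using bnpc_convex_dist[OF assms(1) c'(1) assms(2), of "1/2"] c' by simp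
qed

lemma dist_geo_midpoint_le:
  fixes x y x' y' :: "'x::complete_space"
  assumes "bnpc TYPE('x)"
  shows "dist (geo_midpoint x y) (geo_midpoint x' y') \<le> (dist x x' + dist y y') / 2"
proof -
  obtain c where c: "geodesic c" "c 0 = x" "c 1 = y" using bnpc_geodesic_exists[OF assms] .
  obtain c' where c': "geodesic c'" "c' 0 = x'" "c' 1 = y'" using bnpc_geodesic_exists[OF assms] .
  show ?thesis
    using bnpc_convex_dist[OF assms c(1) c'(1), of "1/2"] c c'
      geo_midpoint_eq[OF assms c(1)] geo_midpoint_eq[OF assms c'(1)] by simp
qed

lemma geo_midpoint_self:
  fixes x :: "'x::complete_space"
  assumes "bnpc TYPE('x)"
  shows "geo_midpoint x x = x"
  using geo_midpoint_eq[OF assms geodesic_const, of x] by simp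

lemma geo_midpoint_isometry:
  fixes f :: "'x::complete_space \<Rightarrow> 'x"
  assumes "bnpc TYPE('x)" and iso: "\<And>x y. dist (f x) (f y) = dist x y"
  shows "geo_midpoint (f x) (f y) = f (geo_midpoint x y)"
proof -
  obtain c where c: "geodesic c" "c 0 = x" "c 1 = y" using bnpc_geodesic_exists[OF assms(1)] .
  have "geodesic (\<lambda>t. f (c t))" using c(1) unfolding geodesic_def iso .
  from geo_midpoint_eq[OF assms(1) this] geo_midpoint_eq[OF assms(1) c(1)]
  show ?thesis by (simp only: c(2,3))
qed

text \<open>This is the form of uniform convexity that survives integration: since it is linear in the
  squares of the distances, integrating it gives uniform convexity of a space of square integrable
  maps. Either the distances of \<open>p\<close> to \<open>x\<close> and \<open>y\<close> differ
  substantially, so that the parallelogram defect of the real numbers alone is large, or they are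
  comparable and the modulus \<open>\<delta>\<close> makes the distance to the midpoint drop.\<close>

lemma uniformly_convex_square_defect:
  assumes b: "bnpc TYPE('x::complete_space)" and u: "uniformly_convex TYPE('x)" and "\<epsilon> > 0"
  obtains C where "C \<ge> 0"
    "\<And>p x y :: 'x. (dist x y)\<^sup>2 + C * (dist p (geo_midpoint x y))\<^sup>2
       \<le> \<epsilon>\<^sup>2 * ((dist p x)\<^sup>2 + (dist p y)\<^sup>2) + C * (((dist p x)\<^sup>2 + (dist p y)\<^sup>2) / 2)"
proof -
  obtain \<delta>' where \<delta>': "\<delta>' > 0"
    "\<And>r (x::'x) y1 y2. r > 0 \<Longrightarrow> dist x y1 \<le> r \<Longrightarrow> dist x y2 \<le> r \<Longrightarrow> dist y1 y2 \<ge> \<epsilon> * r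
        \<Longrightarrow> r - dist x (geo_midpoint y1 y2) \<ge> \<delta>' * r"
    using u \<open>\<epsilon> > 0\<close> unfolding uniformly_convex_def by meson
  define \<delta> where "\<delta> = min \<delta>' 1"
  have \<delta>: "0 < \<delta>" "\<delta> \<le> 1" "\<delta> \<le> \<delta>'" using \<delta>' by (auto simp: \<delta>_def)
  \<comment> \<open>A factor \<open>16\<close> undoes the constant of the defect bound below, a factor \<open>4\<close> comes from
    the square of \<open>dist x y \<le> 2 * r\<close>.\<close>
  define C where "C = 64 / \<delta>\<^sup>2"
  have C0: "C \<ge> 0" by (simp add: C_def)
  have arith: "u - z \<le> (p + q) / 2 - w" if "u \<le> p" "u \<le> q" "w \<le> z" for u z p q w :: real
    using that unfolding add_divide_distrib by linarith
  have main: "(dist x y)\<^sup>2 + C * (dist p (geo_midpoint x y))\<^sup>2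
       \<le> \<epsilon>\<^sup>2 * ((dist p x)\<^sup>2 + (dist p y)\<^sup>2) + C * (((dist p x)\<^sup>2 + (dist p y)\<^sup>2) / 2)"
    for p x y :: 'x
  proof -
    define a b' m D where "a = dist p x" and "b' = dist p y" and "m = dist p (geo_midpoint x y)"
      and "D = dist x y"
    define r where "r = max a b'"
    have nn: "a \<ge> 0" "b' \<ge> 0" "m \<ge> 0" "D \<ge> 0" by (auto simp: a_def b'_def m_def D_def)
    have m1: "m \<le> (a + b') / 2"
      using dist_geo_midpoint_le[OF b, of p p x y] by (simp add: geo_midpoint_self[OF b] m_def a_def b'_def)
    have D1: "D \<le> a + b'" unfolding D_def a_def b'_def by (metis dist_commute dist_triangle)
    have sq: "m\<^sup>2 \<le> (a\<^sup>2 + b'\<^sup>2) / 2 - (a - b')\<^sup>2 / 4"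
    proof -
      have "m\<^sup>2 \<le> ((a + b') / 2)\<^sup>2" using m1 nn by (intro power_mono) auto
      also have "\<dots> = (a\<^sup>2 + b'\<^sup>2) / 2 - (a - b')\<^sup>2 / 4" by (simp add: power2_eq_square field_simps)
      finally show ?thesis .
    qed
    have sqle: "r\<^sup>2 \<le> a\<^sup>2 + b'\<^sup>2" by (auto simp: r_def max_def)
    have "D\<^sup>2 + C * m\<^sup>2 \<le> \<epsilon>\<^sup>2 * (a\<^sup>2 + b'\<^sup>2) + C * ((a\<^sup>2 + b'\<^sup>2) / 2)"
    proof (cases "D < \<epsilon> * r \<or> r \<le> 0")
      case True
      have "D\<^sup>2 \<le> (\<epsilon> * r)\<^sup>2"
      proof (cases "D < \<epsilon> * r")
        case True then show ?thesis using nn by (intro power_mono) auto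
      next
        case False
        then have "r \<le> 0" using True by simp
        then have "D = 0" using D1 nn by (auto simp: r_def)
        then show ?thesis by simp
      qed
      also have "\<dots> = \<epsilon>\<^sup>2 * r\<^sup>2" by (simp add: power_mult_distrib)
      also have "\<dots> \<le> \<epsilon>\<^sup>2 * (a\<^sup>2 + b'\<^sup>2)" using sqle by (intro mult_left_mono) auto
      finally have 1: "D\<^sup>2 \<le> \<epsilon>\<^sup>2 * (a\<^sup>2 + b'\<^sup>2)" .
      have "m\<^sup>2 \<le> (a\<^sup>2 + b'\<^sup>2) / 2" using sq zero_le_power2[of "a - b'"] by linarith
      with C0 have "C * m\<^sup>2 \<le> C * ((a\<^sup>2 + b'\<^sup>2) / 2)" by (intro mult_left_mono)
      with 1 show ?thesis by linarith
    next
      case False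
      then have r: "r > 0" "D \<ge> \<epsilon> * r" by auto
      have "r - m \<ge> \<delta>' * r" unfolding m_def using r
        by (intro \<delta>'(2)) (auto simp: r_def a_def b'_def D_def)
      moreover have "\<delta> * r \<le> \<delta>' * r" using \<delta> r by (intro mult_right_mono) auto
      ultimately have m2: "m \<le> (1 - \<delta>) * r" by (simp add: algebra_simps)
      have defect: "(\<delta>\<^sup>2 / 16) * r\<^sup>2 \<le> (a\<^sup>2 + b'\<^sup>2) / 2 - m\<^sup>2"
      proof (cases "\<bar>a - b'\<bar> \<ge> \<delta> / 2 * r")
        case True
        then have "(\<delta> / 2 * r)\<^sup>2 \<le> \<bar>a - b'\<bar>\<^sup>2" using r \<delta> by (intro power_mono) auto
        then have "\<delta>\<^sup>2 * r\<^sup>2 / 4 \<le> (a - b')\<^sup>2" by (simp add: power_mult_distrib power_divide)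
        then have "\<delta>\<^sup>2 * r\<^sup>2 / 4 / 4 \<le> (a - b')\<^sup>2 / 4" by simp
        also have "\<dots> \<le> (a\<^sup>2 + b'\<^sup>2) / 2 - m\<^sup>2" using sq by argo
        finally show ?thesis by simp
      next
        case False
        have comparable: "a \<ge> r - t \<and> b' \<ge> r - t" if "\<bar>a - b'\<bar> < t" for t
          using that unfolding r_def by linarith
        have "(1 - \<delta>/2) * r = r - \<delta>/2 * r" by (simp add: left_diff_distrib)
        with False comparable[of "\<delta> / 2 * r"]
        have ab: "a \<ge> (1 - \<delta>/2) * r" "b' \<ge> (1 - \<delta>/2) * r" by (simp_all only: not_le)
        have pos: "(1 - \<delta>/2) * r \<ge> 0" using \<delta> r by simp
        have "((1 - \<delta>/2) * r)\<^sup>2 \<le> a\<^sup>2" "((1 - \<delta>/2) * r)\<^sup>2 \<le> b'\<^sup>2"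
          using ab pos by (auto intro!: power_mono)
        moreover have "m\<^sup>2 \<le> ((1 - \<delta>) * r)\<^sup>2" using m2 nn by (intro power_mono) auto
        ultimately have "((1 - \<delta>/2) * r)\<^sup>2 - ((1 - \<delta>) * r)\<^sup>2 \<le> (a\<^sup>2 + b'\<^sup>2) / 2 - m\<^sup>2"
          by (rule arith)
        moreover have "((1 - \<delta>/2) * r)\<^sup>2 - ((1 - \<delta>) * r)\<^sup>2 = (\<delta> - 3/4 * \<delta>\<^sup>2) * r\<^sup>2"
          by (simp add: power2_eq_square field_simps)
        moreover have "\<delta>\<^sup>2 / 16 \<le> \<delta> - 3/4 * \<delta>\<^sup>2"
        proof -
          have "\<delta> * \<delta> \<le> \<delta> * 1" using \<delta> by (intro mult_left_mono) auto
          then show ?thesis unfolding power2_eq_square using \<delta> by linarith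
        qed
        then have "(\<delta>\<^sup>2 / 16) * r\<^sup>2 \<le> (\<delta> - 3/4 * \<delta>\<^sup>2) * r\<^sup>2" by (intro mult_right_mono) auto
        ultimately show ?thesis by linarith
      qed
      have "D \<le> 2 * r" using D1 by (auto simp: r_def)
      then have "D\<^sup>2 \<le> (2 * r)\<^sup>2" using nn by (intro power_mono) auto
      also have "\<dots> = C * ((\<delta>\<^sup>2 / 16) * r\<^sup>2)" using \<delta> by (simp add: C_def power2_eq_square)
      also have "\<dots> \<le> C * ((a\<^sup>2 + b'\<^sup>2) / 2 - m\<^sup>2)" using defect C0 by (intro mult_left_mono)
      finally have "D\<^sup>2 + C * m\<^sup>2 \<le> C * ((a\<^sup>2 + b'\<^sup>2) / 2)" by (simp add: algebra_simps)
      moreover have "0 \<le> \<epsilon>\<^sup>2 * (a\<^sup>2 + b'\<^sup>2)" by simp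
      ultimately show ?thesis by linarith
    qed
    then show ?thesis by (simp add: a_def b'_def m_def D_def)
  qed
  show ?thesis by (rule that[OF C0 main])
qed

section \<open>Minimizing and Cauchy sequences\<close>

text \<open>The minimization has two stages. Among the \<open>1/(n+1)\<close>-almost minimizers of \<open>J\<close> one takes an
  almost minimizer of \<open>N\<close>. Since midpoints do not leave the class of almost minimizers of \<open>J\<close>, the value of \<open>N\<close>
  cannot drop there, while the constrained infima of \<open>N\<close> increase to a limit that coercivity keeps
  finite. In the application \<open>N\<close> is a squared norm, and the smallness of the defect forces the
  sequence to be Cauchy.\<close>

lemma minimizing_sequence_small_defect:
  fixes J N :: "'s \<Rightarrow> real"
  assumes "S \<noteq> {}" and J0: "\<And>s. s \<in> S \<Longrightarrow> 0 \<le> J s" and N0: "\<And>s. s \<in> S \<Longrightarrow> 0 \<le> N s"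
    and mid: "\<And>s t. s \<in> S \<Longrightarrow> t \<in> S \<Longrightarrow> mid s t \<in> S \<and> J (mid s t) \<le> (J s + J t) / 2"
    and coercive: "\<And>s. s \<in> S \<Longrightarrow> N s \<le> A * J s + B" and "A \<ge> 0"
  obtains s where "\<And>n::nat. s n \<in> S" "\<And>n. J (s n) \<le> Inf (J ` S) + 1 / Suc n"
    "\<And>\<epsilon>. \<epsilon> > 0 \<Longrightarrow> \<exists>M. \<forall>m\<ge>M. \<forall>n\<ge>M. (N (s m) + N (s n)) / 2 - N (mid (s m) (s n)) < \<epsilon>"
proof -
  define a where "a = Inf (J ` S)"
  define C where "C n = {s \<in> S. J s \<le> a + 1 / Suc n}" for n
  define r where "r n = Inf (N ` C n)" for n
  have bddJ: "bdd_below (J ` S)" using J0 by (intro bdd_belowI[of _ 0]) auto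
  have bddN: "bdd_below (N ` C n)" for n using N0 by (intro bdd_belowI[of _ 0]) (auto simp: C_def)
  have Cne: "C n \<noteq> {}" for n
  proof -
    have "\<exists>x\<in>J ` S. x < a + 1 / Suc n"
      using cInf_lessD[of "J ` S" "a + 1 / Suc n"] assms(1) by (auto simp: a_def)
    then show ?thesis by (force simp: C_def)
  qed
  have Canti: "C n \<subseteq> C m" if "m \<le> n" for m n
  proof -
    have "1 / real (Suc n) \<le> 1 / Suc m" using that by (intro divide_left_mono) auto
    then show ?thesis by (auto simp: C_def)
  qed
  have rmono: "mono r" unfolding r_def
  proof (rule monoI)
    fix m n :: nat assume "m \<le> n"
    show "Inf (N ` C m) \<le> Inf (N ` C n)"
      using Cne[of n] bddN[of m] Canti[OF \<open>m \<le> n\<close>] by (intro cInf_superset_mono) auto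
  qed
  have rbd: "r n \<le> A * (a + 1) + B" for n
  proof -
    obtain s where s: "s \<in> C n" using Cne by blast
    have "r n \<le> N s" unfolding r_def using s bddN by (intro cInf_lower) auto
    also have "\<dots> \<le> A * J s + B" using s coercive by (simp add: C_def)
    also have "J s \<le> a + 1 / Suc n" using s by (simp add: C_def)
    also have "\<dots> \<le> a + 1" by simp
    finally show ?thesis using \<open>A \<ge> 0\<close> by (simp add: mult_left_mono)
  qed
  obtain R where R: "r \<longlonglongrightarrow> R" "\<And>n. r n \<le> R"
    by (rule incseq_convergent[OF rmono, of "A * (a + 1) + B"]) (use rbd in auto)
  have "\<exists>s. s \<in> C n \<and> N s \<le> r n + 1 / Suc n" for n
  proof -
    have "\<exists>x\<in>N ` C n. x < r n + 1 / Suc n"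
      using cInf_lessD[of "N ` C n" "r n + 1 / Suc n"] Cne by (auto simp: r_def)
    then show ?thesis by force
  qed
  then obtain s where s: "\<And>n. s n \<in> C n" "\<And>n. N (s n) \<le> r n + 1 / Suc n" by metis
  show ?thesis
  proof (rule that[of s])
    show "s n \<in> S" for n using s(1) by (simp add: C_def)
    show "J (s n) \<le> Inf (J ` S) + 1 / Suc n" for n using s(1)[of n] by (simp add: C_def a_def)
    have arith: "(p + q) / 2 - x < e" if "p \<le> R + h" "q \<le> R + h" "y \<le> x" "R - e < y - h"
      for p q x y h e :: real using that unfolding add_divide_distrib by linarith
    fix \<epsilon> :: real assume "\<epsilon> > 0"
    have "(\<lambda>n. r n - 1 / Suc n) \<longlonglongrightarrow> R - 0"
      using R(1) LIMSEQ_inverse_real_of_nat by (intro tendsto_diff) (simp_all add: inverse_eq_divide)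
    then have "eventually (\<lambda>n. r n - 1 / Suc n > R - \<epsilon>) sequentially"
      using \<open>\<epsilon> > 0\<close> by (intro order_tendstoD(1)[where y = "R - 0"]) auto
    then obtain M where M: "r M - 1 / Suc M > R - \<epsilon>" by (auto simp: eventually_sequentially)
    show "\<exists>M. \<forall>m\<ge>M. \<forall>n\<ge>M. (N (s m) + N (s n)) / 2 - N (mid (s m) (s n)) < \<epsilon>"
    proof (intro exI allI impI)
      fix m n assume "m \<ge> M" "n \<ge> M"
      have inC: "s m \<in> C M" "s n \<in> C M" using s(1) Canti \<open>m \<ge> M\<close> \<open>n \<ge> M\<close> by blast+
      have "mid (s m) (s n) \<in> C M" using inC mid[of "s m" "s n"] by (auto simp: C_def)
      then have 1: "r M \<le> N (mid (s m) (s n))" unfolding r_def using bddN by (intro cInf_lower) auto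
      have "1 / real (Suc m) \<le> 1 / Suc M" "1 / real (Suc n) \<le> 1 / Suc M"
        using \<open>m \<ge> M\<close> \<open>n \<ge> M\<close> by (auto intro!: divide_left_mono)
      then have "N (s m) \<le> R + 1 / Suc M" "N (s n) \<le> R + 1 / Suc M"
        using s(2)[of m] s(2)[of n] R(2)[of m] R(2)[of n] by linarith+
      then show "(N (s m) + N (s n)) / 2 - N (mid (s m) (s n)) < \<epsilon>"
        by (rule arith[OF _ _ 1 M])
    qed
  qed
qed

lemma geometric_steps_Cauchy:
  fixes x :: "nat \<Rightarrow> 'x::metric_space"
  assumes step: "\<And>k. dist (x k) (x (Suc k)) \<le> C * (1/2) ^ k"
  shows "Cauchy x"
proof -
  have bound: "dist (x m) (x (m + j)) + 2 * C * (1/2) ^ (m + j) \<le> 2 * C * (1/2) ^ m" for m j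
  proof (induction j)
    case (Suc j)
    have "dist (x m) (x (m + Suc j)) \<le> dist (x m) (x (m + j)) + dist (x (m + j)) (x (Suc (m + j)))"
      using dist_triangle by simp
    also have "dist (x (m + j)) (x (Suc (m + j))) \<le> C * (1/2) ^ (m + j)" by (rule step)
    finally show ?case using Suc by simp
  qed simp
  have C: "0 \<le> C" using order_trans[OF zero_le_dist step[of 0]] by simp
  have bound': "dist (x m) (x n) \<le> 2 * C * (1/2) ^ m" if "m \<le> n" for m n
  proof -
    have "0 \<le> 2 * C * (1/2) ^ n" using C by simp
    with bound[of m "n - m"] that show ?thesis by simp
  qed
  have "(\<lambda>m. 2 * C * (1/2) ^ m) \<longlonglongrightarrow> 2 * C * 0"
    by (intro tendsto_mult LIMSEQ_realpow_zero) auto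
  show ?thesis
  proof (rule metric_CauchyI)
    fix e :: real assume "0 < e"
    have "\<forall>\<^sub>F m in sequentially. 2 * C * (1/2) ^ m < e / 2"
      using order_tendstoD(2)[OF \<open>(\<lambda>m. 2 * C * (1/2) ^ m) \<longlonglongrightarrow> 2 * C * 0\<close>, of "e / 2"] \<open>0 < e\<close> by simp
    then obtain M where M: "2 * C * (1/2) ^ M < e / 2" by (auto simp: eventually_sequentially)
    have "dist (x m) (x n) < e" if "m \<ge> M" "n \<ge> M" for m n
    proof -
      have "dist (x m) (x n) \<le> dist (x M) (x m) + dist (x M) (x n)" by (rule dist_triangle3)
      with bound'[OF that(1)] bound'[OF that(2)] M show ?thesis by linarith
    qed
    then show "\<exists>M. \<forall>m\<ge>M. \<forall>n\<ge>M. dist (x m) (x n) < e" by (intro exI[of _ M] allI impI)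
  qed
qed

section \<open>Maps with separable range\<close>

lemma dist_eq_INF_dense:
  fixes x y :: "'x::metric_space"
  assumes "x \<in> closure D"
  shows "ennreal (dist x y) = (INF d\<in>D. ennreal (dist x d + dist d y))"
proof (rule antisym)
  show "ennreal (dist x y) \<le> (INF d\<in>D. ennreal (dist x d + dist d y))"
    by (intro INF_greatest ennreal_leI dist_triangle)
  show "(INF d\<in>D. ennreal (dist x d + dist d y)) \<le> ennreal (dist x y)"
  proof (rule ennreal_le_epsilon)
    fix e :: real assume "e > 0"
    obtain d where d: "d \<in> D" "dist d x < e / 2"
      using assms \<open>e > 0\<close> unfolding closure_approachable by (meson half_gt_zero)
    have "dist x d + dist d y \<le> dist x y + e"
      using d(2) dist_triangle[of d y x] by (simp add: dist_commute)
    then have "ennreal (dist x d + dist d y) \<le> ennreal (dist x y + e)" by (rule ennreal_leI)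
    also have "\<dots> = ennreal (dist x y) + ennreal e"
      using \<open>e > 0\<close> by (intro ennreal_plus) auto
    finally show "(INF d\<in>D. ennreal (dist x d + dist d y)) \<le> ennreal (dist x y) + ennreal e"
      using d(1) by (meson INF_lower2)
  qed
qed

text \<open>On a space that is not second countable the distance need not be measurable for the product
  of the Borel sigma-algebras. If one of the two maps is separably valued, the distance is an infimum
  of measurable functions over a countable dense set.\<close>

lemma borel_measurable_dist_separable:
  fixes f g :: "'a \<Rightarrow> 'x::metric_space"
  assumes [measurable]: "f \<in> borel_measurable M" "g \<in> borel_measurable M"
    and D: "countable D" "\<And>x. x \<in> space M \<Longrightarrow> f x \<in> closure D"
  shows "(\<lambda>x. dist (f x) (g x)) \<in> borel_measurable M"
proof -
  have to_point[measurable]: "(\<lambda>x. dist (h x) d) \<in> borel_measurable M"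
    if [measurable]: "h \<in> borel_measurable M" for h and d :: 'x
    by (rule measurable_compose[OF that]) (intro borel_measurable_continuous_onI continuous_intros)
  have [measurable]: "(\<lambda>x. dist d (g x)) \<in> borel_measurable M" for d
    using to_point[OF assms(2)] by (simp add: dist_commute)
  have "(\<lambda>x. INF d\<in>D. ennreal (dist (f x) d + dist d (g x))) \<in> borel_measurable M"
    using D(1) by measurable
  then have "(\<lambda>x. ennreal (dist (f x) (g x))) \<in> borel_measurable M"
    by (rule measurable_cong[THEN iffD1, rotated])
       (simp only: dist_eq_INF_dense[OF D(2), symmetric])
  then have "(\<lambda>x. enn2real (ennreal (dist (f x) (g x)))) \<in> borel_measurable M" by measurable
  then show ?thesis by simp
qed

lemma countably_valued_approximation:
  fixes f :: "'a \<Rightarrow> 'x::metric_space"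
  assumes f: "f \<in> borel_measurable M"
    and D: "countable D" "\<And>x. f x \<in> closure D"
  shows "\<exists>(i :: nat \<Rightarrow> 'a \<Rightarrow> nat) d. \<forall>n x. i n \<in> measurable M (count_space UNIV) \<and> (\<lambda>n. d (i n x)) \<longlonglongrightarrow> f x"
proof -
  have "D \<noteq> {}" using D(2) by auto
  then have rg: "range (from_nat_into D) = D" using D(1) by (rule range_from_nat_into)
  define d where "d = from_nat_into D"
  define i where "i n x = (LEAST i. dist (f x) (d i) < 1 / Suc n)" for n x
  have ex: "\<exists>i. dist (f x) (d i) < 1 / Suc n" for n x
  proof -
    have "0 < 1 / real (Suc n)" by simp
    then obtain e where "e \<in> D" "dist e (f x) < 1 / Suc n"
      using D(2)[of x] unfolding closure_approachable by meson
    then show ?thesis using rg unfolding d_def by (metis dist_commute imageE)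
  qed
  have close: "dist (f x) (d (i n x)) < 1 / Suc n" for n x
    unfolding i_def using LeastI_ex[OF ex] .
  have [measurable]: "(\<lambda>x. dist (f x) e) \<in> borel_measurable M" for e
    by (rule measurable_compose[OF f]) (intro borel_measurable_continuous_onI continuous_intros)
  show ?thesis
  proof (intro exI[of _ i] exI[of _ d] allI conjI)
    show "i n \<in> measurable M (count_space UNIV)" for n unfolding i_def by measurable
    show "(\<lambda>n. d (i n x)) \<longlonglongrightarrow> f x" for x
    proof (rule metric_LIMSEQ_I)
      fix r :: real assume "0 < r"
      then obtain N where N: "inverse (real (Suc N)) < r" using reals_Archimedean by blast
      have "dist (d (i n x)) (f x) < r" if "n \<ge> N" for n
      proof -
        have "dist (f x) (d (i n x)) < 1 / Suc n" by (rule close)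
        also have "\<dots> \<le> 1 / Suc N" using that by (intro divide_left_mono) auto
        finally show ?thesis using N by (simp add: dist_commute inverse_eq_divide)
      qed
      then show "\<exists>N. \<forall>n\<ge>N. dist (d (i n x)) (f x) < r" by (intro exI[of _ N] allI impI)
    qed
  qed
qed

text \<open>Without separability the pair of two Borel maps need not be Borel. Approximating both maps by
  maps with countably many values avoids the pair.\<close>

lemma borel_measurable_continuous_separable2:
  fixes f g :: "'a \<Rightarrow> 'x::metric_space" and h :: "'x \<Rightarrow> 'x \<Rightarrow> 'y::metric_space"
  assumes "f \<in> borel_measurable M" "countable D" "\<And>x. f x \<in> closure D"
    and "g \<in> borel_measurable M" "countable E" "\<And>x. g x \<in> closure E"
    and h: "continuous_on UNIV (\<lambda>p. h (fst p) (snd p))"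
  shows "(\<lambda>x. h (f x) (g x)) \<in> borel_measurable M"
proof -
  obtain i d where "\<forall>(n::nat) x. i n \<in> measurable M (count_space (UNIV::nat set)) \<and> (\<lambda>n. d (i n x)) \<longlonglongrightarrow> f x"
    using countably_valued_approximation[OF assms(1-3)] by (elim exE)
  then have i: "i n \<in> measurable M (count_space UNIV)" and d: "(\<lambda>n. d (i n x)) \<longlonglongrightarrow> f x" for n x
    by simp_all
  obtain j e where "\<forall>(n::nat) x. j n \<in> measurable M (count_space (UNIV::nat set)) \<and> (\<lambda>n. e (j n x)) \<longlonglongrightarrow> g x"
    using countably_valued_approximation[OF assms(4-6)] by (elim exE)
  then have j: "j n \<in> measurable M (count_space UNIV)" and e: "(\<lambda>n. e (j n x)) \<longlonglongrightarrow> g x" for n x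
    by simp_all
  show ?thesis
  proof (rule borel_measurable_LIMSEQ_metric)
    show "(\<lambda>x. h (d (i n x)) (e (j n x))) \<in> borel_measurable M" for n
    proof (rule measurable_compose_countable[OF _ i[of n]])
      show "(\<lambda>x. h (d k) (e (j n x))) \<in> borel_measurable M" for k
        by (rule measurable_compose_countable[OF _ j[of n]]) simp
    qed
    show "(\<lambda>n. h (d (i n x)) (e (j n x))) \<longlonglongrightarrow> h (f x) (g x)" for x
      using continuous_on_tendsto_compose[OF h tendsto_Pair[OF d[of x] e[of x]]] by simp
  qed
qed

lemma continuous_geo_midpoint:
  assumes "bnpc TYPE('x::complete_space)"
  shows "continuous_on UNIV (\<lambda>p. geo_midpoint (fst p) (snd p :: 'x))"
  unfolding continuous_on_def
proof safe
  fix x y :: 'x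
  show "((\<lambda>p. geo_midpoint (fst p) (snd p)) \<longlongrightarrow> geo_midpoint (fst (x, y)) (snd (x, y))) (at (x, y) within UNIV)"
  proof (rule metric_tendsto_imp_tendsto)
    have "((\<lambda>p. (dist (fst p) x + dist (snd p) y) / 2) \<longlongrightarrow> (dist (fst (x, y)) x + dist (snd (x, y)) y) / 2)
        (at (x, y) within UNIV)"
      by (intro tendsto_intros) auto
    then show "((\<lambda>p. (dist (fst p) x + dist (snd p) y) / 2) \<longlongrightarrow> 0) (at (x, y) within UNIV)" by simp
    show "\<forall>\<^sub>F p in at (x, y) within UNIV. dist (geo_midpoint (fst p) (snd p)) (geo_midpoint (fst (x, y)) (snd (x, y)))
       \<le> dist ((dist (fst p) x + dist (snd p) y) / 2) 0"
      using dist_geo_midpoint_le[OF assms] by (intro always_eventually) simp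
  qed
qed

lemma geo_midpoint_in_closure:
  fixes x y :: "'x::complete_space"
  assumes "bnpc TYPE('x)" "x \<in> closure D" "y \<in> closure E"
  shows "geo_midpoint x y \<in> closure ((\<lambda>p. geo_midpoint (fst p) (snd p)) ` (D \<times> E))"
proof -
  have "(\<lambda>p. geo_midpoint (fst p) (snd p)) ` closure (D \<times> E)
      \<subseteq> closure ((\<lambda>p. geo_midpoint (fst p) (snd p)) ` (D \<times> E))"
    by (intro image_closure_subset continuous_on_subset[OF continuous_geo_midpoint[OF assms(1)]]
        closure_subset) auto
  moreover have "(x, y) \<in> closure (D \<times> E)" using assms by (simp add: closure_Times)
  ultimately show ?thesis by force
qed

section \<open>Compact generation and Haar measure\<close>

lemma compact_set_power:
  fixes K :: "'g::topological_group_add set"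
  assumes "compact K"
  shows "compact (set_power K n)"
proof (induction n)
  case (Suc n)
  have "set_power K (Suc n) = (\<lambda>p. fst p + snd p) ` (set_power K n \<times> K)" by force
  moreover have "compact \<dots>"
    by (intro compact_continuous_image continuous_intros compact_Times Suc assms)
  ultimately show ?case by simp
qed simp

lemma set_power_add:
  "a \<in> set_power K m \<Longrightarrow> b \<in> set_power K n \<Longrightarrow> a + b \<in> set_power K (m + n)"
proof (induction n arbitrary: b)
  case (Suc n)
  then obtain c d where "b = c + d" "c \<in> set_power K n" "d \<in> K" by auto
  moreover have "a + c \<in> set_power K (m + n)" using Suc calculation by blast
  ultimately show ?case by (force simp: add.assoc[symmetric])
qed simp

lemma in_set_power_word_length:
  assumes "compact_generating_set K"
  shows "g \<in> set_power K (word_length K g)"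
proof -
  have "\<exists>n. g \<in> set_power K n" using assms by (auto simp: compact_generating_set_def)
  then show ?thesis unfolding word_length_def by (rule LeastI_ex)
qed

lemma word_length_le: "g \<in> set_power K n \<Longrightarrow> word_length K g \<le> n"
  unfolding word_length_def by (rule Least_le)

lemma word_length_add_le:
  assumes "compact_generating_set K"
  shows "word_length K (a + b) \<le> word_length K a + word_length K b"
  by (intro word_length_le set_power_add in_set_power_word_length assms)

lemma compact_word_length_ball:
  assumes "compact_generating_set K"
  shows "compact {g. word_length K g \<le> n}"
proof -
  have "{g. word_length K g \<le> n} = (\<Union>k\<le>n. set_power K k)"
  proof safe
    fix g assume "word_length K g \<le> n"
    with in_set_power_word_length[OF assms, of g] show "g \<in> (\<Union>k\<le>n. set_power K k)" by blast
  next
    fix g k assume "k \<le> n" "g \<in> set_power K k"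
    then show "word_length K g \<le> n" using word_length_le by (meson order_trans)
  qed
  moreover have "compact (\<Union>k\<le>n. set_power K k)"
    using assms by (intro compact_UN compact_set_power) (auto simp: compact_generating_set_def)
  ultimately show ?thesis by simp
qed

lemma translation_image: "(+) a ` A = (\<lambda>g. - a + g) -` (A :: 'g::group_add set)"
  by (auto simp: image_iff add.assoc[symmetric] intro!: bexI[of _ "- a + _"])

lemma open_translation:
  fixes U :: "'g::topological_group_add set"
  assumes "open U"
  shows "open ((+) a ` U)"
  unfolding translation_image using assms by (simp add: open_vimage continuous_on_add)

text \<open>By the Baire category theorem one of the countably many compact balls of the word length has
  interior points; translates of this interior cover a compact set.\<close>

lemma word_length_bounded_on_compact:
  fixes K C :: "'g::{topological_group_add,t2_space} set"
  assumes lc: "locally_compact_space (euclidean :: 'g topology)"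
    and K: "compact_generating_set K" and "compact C"
  obtains n where "\<And>g. g \<in> C \<Longrightarrow> word_length K g \<le> n"
proof -
  define B where "B n = {g. word_length K g \<le> n}" for n
  have clB: "closed (B n)" for n
    unfolding B_def by (intro compact_imp_closed compact_word_length_ball K)
  have "\<exists>n. interior (B n) \<noteq> {}"
  proof (rule ccontr)
    assume "\<not> ?thesis"
    then have empt: "interior (B n) = {}" for n by blast
    have "Hausdorff_space (euclidean :: 'g topology)"
      unfolding Hausdorff_space_def by (auto simp: disjnt_def separation_t2)
    then have "regular_space (euclidean :: 'g topology)"
      using lc locally_compact_Hausdorff_imp_regular_space by blast
    then have "euclidean interior_of \<Union>(range B) = {}"
      using lc empt clB by (intro Baire_category_alt) auto
    moreover have "\<Union>(range B) = UNIV" by (auto simp: B_def)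
    ultimately show False by simp
  qed
  then obtain n u where u: "u \<in> interior (B n)" by blast
  define U where "U g = (+) (g - u) ` interior (B n)" for g
  have "open (U g)" for g unfolding U_def by (intro open_translation) simp
  moreover have "g \<in> U g" for g unfolding U_def using u by (intro image_eqI[of _ _ u]) (auto simp: add.assoc)
  ultimately obtain D where D: "finite D" "C \<subseteq> (\<Union>g\<in>D. U g)"
    using compactE_image[OF \<open>compact C\<close>, of C U] by (metis UN_iff subsetI)
  define N where "N = Max (insert 0 ((\<lambda>g. word_length K (g - u)) ` D))"
  show ?thesis
  proof (rule that)
    fix c assume "c \<in> C"
    then obtain g where g: "g \<in> D" "c \<in> U g" using D by blast
    then obtain b where b: "b \<in> interior (B n)" "c = g - u + b" by (auto simp: U_def)
    have "word_length K c \<le> word_length K (g - u) + word_length K b"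
      unfolding b(2) by (rule word_length_add_le[OF K])
    also have "word_length K (g - u) \<le> N" unfolding N_def using D(1) g(1) by (intro Max_ge) auto
    also have "word_length K b \<le> n" using b(1) interior_subset by (auto simp: B_def)
    finally show "word_length K c \<le> N + n" by simp
  qed
qed

lemma measurable_word_length:
  fixes K :: "'g::{topological_group_add,t2_space} set"
  assumes "compact_generating_set K"
  shows "word_length K \<in> measurable borel (count_space UNIV)"
proof -
  have ball: "{g. word_length K g \<le> n} \<in> sets borel" for n
    by (intro borel_closed compact_imp_closed compact_word_length_ball assms)
  have "{g. word_length K g = n} \<in> sets borel" for n
  proof (cases n)
    case 0
    then have "{g. word_length K g = n} = {g. word_length K g \<le> 0}" by auto
    then show ?thesis by (simp only: ball)
  next
    case (Suc m)
    then have "{g. word_length K g = n} = {g. word_length K g \<le> n} - {g. word_length K g \<le> m}" by auto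
    then show ?thesis by (simp only: ball sets.Diff)
  qed
  then show ?thesis
    by (subst measurable_count_space_eq2_countable) (auto simp: vimage_def)
qed

lemma borel_measurable_energy_weight:
  fixes K :: "'g::{topological_group_add,t2_space} set"
  assumes "compact_generating_set K"
  shows "energy_weight K \<in> borel_measurable borel"
  unfolding energy_weight_def
  by (rule measurable_compose[OF measurable_word_length[OF assms]]) simp

lemma measurable_translation [measurable]:
  fixes a :: "'g::topological_group_add"
  shows "(\<lambda>g. a + g) \<in> borel_measurable borel"
  by (intro borel_measurable_continuous_onI continuous_intros)

lemma haar_sets: "haar_measure \<mu> \<Longrightarrow> sets \<mu> = sets borel"
  unfolding haar_measure_def by (elim conjE)

lemma haar_UNIV_nonzero: "haar_measure \<mu> \<Longrightarrow> emeasure \<mu> UNIV \<noteq> 0"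
  unfolding haar_measure_def by (elim conjE)

lemma haar_compact_finite:
  assumes "haar_measure \<mu>" "compact C"
  shows "emeasure \<mu> C < \<infinity>"
proof -
  have "\<forall>C. compact C \<longrightarrow> emeasure \<mu> C < \<infinity>"
    using assms(1) unfolding haar_measure_def by (elim conjE)
  with assms(2) show ?thesis by simp
qed

lemma haar_image:
  assumes "haar_measure \<mu>" "A \<in> sets borel"
  shows "emeasure \<mu> ((+) g ` A) = emeasure \<mu> A"
proof -
  have "\<forall>g. \<forall>A\<in>sets borel. emeasure \<mu> ((+) g ` A) = emeasure \<mu> A"
    using assms(1) unfolding haar_measure_def by (elim conjE)
  with assms(2) show ?thesis by blast
qed

lemma haar_outer_approximation:
  assumes "haar_measure \<mu>" "A \<in> sets borel" "emeasure \<mu> A < t"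
  obtains U where "open U" "A \<subseteq> U" "emeasure \<mu> U < t"
proof -
  have "\<forall>A\<in>sets borel. emeasure \<mu> A = (INF U\<in>{U. open U \<and> A \<subseteq> U}. emeasure \<mu> U)"
    using assms(1) unfolding haar_measure_def by (elim conjE)
  then have "emeasure \<mu> A = (INF U\<in>{U. open U \<and> A \<subseteq> U}. emeasure \<mu> U)"
    using assms(2) by (rule bspec)
  from this[symmetric] have "(INF U\<in>{U. open U \<and> A \<subseteq> U}. emeasure \<mu> U) < t" using assms(3) by (simp only:)
  then show ?thesis unfolding INF_less_iff using that by blast
qed

lemma haar_inner_regular:
  assumes "haar_measure \<mu>" "open U"
  shows "emeasure \<mu> U = (SUP C\<in>{C. compact C \<and> C \<subseteq> U}. emeasure \<mu> C)"
proof -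
  have "\<forall>U. open U \<longrightarrow> emeasure \<mu> U = (SUP C\<in>{C. compact C \<and> C \<subseteq> U}. emeasure \<mu> C)"
    using assms(1) unfolding haar_measure_def by (elim conjE)
  with assms(2) show ?thesis by (elim allE impE)
qed

lemma haar_translation_vimage:
  assumes "haar_measure \<mu>" "A \<in> sets borel"
  shows "emeasure \<mu> ((\<lambda>g. a + g) -` A) = emeasure \<mu> A"
  using haar_image[OF assms, of "- a"] translation_image[of "- a" A] by simp

lemma haar_nn_integral_translation:
  assumes \<mu>: "haar_measure \<mu>" and [measurable]: "f \<in> borel_measurable borel"
  shows "(\<integral>\<^sup>+g. f (a + g) \<partial>\<mu>) = (\<integral>\<^sup>+g. f g \<partial>\<mu>)"
proof -
  have sets[measurable_cong]: "sets \<mu> = sets borel" by (rule haar_sets[OF \<mu>])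
  have "distr \<mu> \<mu> (\<lambda>g. a + g) = \<mu>"
  proof (rule measure_eqI)
    fix A assume "A \<in> sets (distr \<mu> \<mu> (\<lambda>g. a + g))"
    then have "A \<in> sets borel" by (simp add: sets)
    then show "emeasure (distr \<mu> \<mu> (\<lambda>g. a + g)) A = emeasure \<mu> A"
      using haar_translation_vimage[OF \<mu>] sets_eq_imp_space_eq[OF sets]
      by (subst emeasure_distr) (auto simp: sets)
  qed simp
  then have "(\<integral>\<^sup>+g. f g \<partial>\<mu>) = (\<integral>\<^sup>+g. f g \<partial>distr \<mu> \<mu> (\<lambda>g. a + g))" by simp
  also have "\<dots> = (\<integral>\<^sup>+g. f (a + g) \<partial>\<mu>)"
    by (rule nn_integral_distr) (simp_all add: measurable_cong_sets[OF sets refl] measurable_cong_sets[OF refl sets])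
  finally show ?thesis by simp
qed

text \<open>The function is upper semicontinuous: an open set that contains the translate of \<open>C\<close> by
  \<open>w\<close> and has little more measure contains the translates by all points near \<open>w\<close>.\<close>

lemma borel_measurable_haar_compact_translate:
  fixes \<mu> :: "'g::{topological_group_add,t2_space} measure"
  assumes \<mu>: "haar_measure \<mu>" and C: "compact C" and A: "A \<in> sets borel"
  shows "(\<lambda>w. emeasure \<mu> {g \<in> A. - w + g \<in> C}) \<in> borel_measurable borel"
proof (rule borel_measurableI_less)
  have sets: "sets \<mu> = sets borel" by (rule haar_sets[OF \<mu>])
  have [measurable]: "C \<in> sets borel" "A \<in> sets borel" using C A by (auto intro: borel_closed compact_imp_closed)
  have Tb: "{g. - w + g \<in> C} \<in> sets borel" for w by measurable
  have Ab: "{g \<in> A. - w + g \<in> C} \<in> sets borel" for w by measurable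
  fix t :: ennreal
  have "open {w. emeasure \<mu> {g \<in> A. - w + g \<in> C} < t}"
  proof (subst open_subopen, safe)
    fix w assume less: "emeasure \<mu> {g \<in> A. - w + g \<in> C} < t"
    let ?T = "{g. - w + g \<in> C}" and ?a = "emeasure \<mu> {g \<in> A. - w + g \<in> C}"
    have fin: "emeasure \<mu> ?T < \<infinity>"
      using haar_translation_vimage[OF \<mu> \<open>C \<in> sets borel\<close>, of "- w"] haar_compact_finite[OF \<mu> C]
      by (simp add: vimage_def)
    have le: "?a \<le> emeasure \<mu> ?T" using Tb by (intro emeasure_mono) (auto simp: sets)
    let ?e = "emeasure \<mu> ?T - ?a"
    have T_eq: "?e + ?a = emeasure \<mu> ?T" using le by (simp add: diff_add_cancel_ennreal)
    have "?e \<noteq> \<infinity>" using fin by (simp add: ennreal_minus_eq_top)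
    with less have "?e + ?a < ?e + t" by (subst ennreal_add_left_cancel_less) simp
    then have lt: "emeasure \<mu> ?T < ?e + t" unfolding T_eq .
    obtain U where U: "open U" "?T \<subseteq> U" "emeasure \<mu> U < ?e + t"
      using haar_outer_approximation[OF \<mu> Tb lt] .
    have "open ((\<lambda>p. fst p + snd p) -` U)"
      using U(1) by (intro open_vimage continuous_intros)
    moreover have "{w} \<times> C \<subseteq> (\<lambda>p. fst p + snd p) -` U"
      using U(2) by (auto simp: subset_eq add.assoc[symmetric])
    ultimately obtain V where V: "w \<in> V" "open V" "V \<times> C \<subseteq> (\<lambda>p. fst p + snd p) -` U"
      using Elementary_Topology.tube_lemma[OF C, of _ w] by meson
    show "\<exists>V. open V \<and> w \<in> V \<and> V \<subseteq> {w. emeasure \<mu> {g \<in> A. - w + g \<in> C} < t}"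
    proof (intro exI conjI subsetI CollectI)
      fix v assume "v \<in> V"
      let ?Av = "{g \<in> A. - v + g \<in> C}"
      have sub: "?Av \<subseteq> U"
      proof
        fix g assume "g \<in> ?Av"
        then have "- v + g \<in> C" by simp
        moreover have "\<forall>x\<in>V. \<forall>y\<in>C. x + y \<in> U" using V(3) by (auto simp: subset_eq)
        ultimately have "v + (- v + g) \<in> U" using \<open>v \<in> V\<close> by blast
        then show "g \<in> U" by (simp add: add.assoc[symmetric])
      qed
      have "emeasure \<mu> ?Av \<le> emeasure \<mu> ({g \<in> A. - w + g \<in> C} \<union> (U - ?T))"
        using sub Ab Tb U(1) by (intro emeasure_mono) (auto simp: sets)
      also have "\<dots> = ?a + emeasure \<mu> (U - ?T)"
        using Ab Tb U(1) by (intro plus_emeasure[symmetric]) (auto simp: sets)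
      also have "emeasure \<mu> (U - ?T) = emeasure \<mu> U - emeasure \<mu> ?T"
        using U Tb fin by (intro emeasure_Diff) (auto simp: sets)
      also have "?a + (emeasure \<mu> U - emeasure \<mu> ?T) < t"
      proof -
        have "emeasure \<mu> ?T \<le> emeasure \<mu> U" using U by (intro emeasure_mono) (auto simp: sets)
        then have "?e + (?a + (emeasure \<mu> U - emeasure \<mu> ?T)) = emeasure \<mu> U"
          unfolding add.assoc[symmetric] T_eq by (simp add: add_diff_inverse_ennreal)
        with U(3) have "?e + (?a + (emeasure \<mu> U - emeasure \<mu> ?T)) < ?e + t" by simp
        then show ?thesis unfolding ennreal_add_left_cancel_less by blast
      qed
      finally show "emeasure \<mu> ?Av < t" .
    qed (use V in auto)
  qed
  then show "{w \<in> space borel. emeasure \<mu> {g \<in> A. - w + g \<in> C} < t} \<in> sets borel" by simp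
qed

text \<open>The product of the Borel sigma-algebras may be smaller than the Borel sigma-algebra of the
  product, so the integrand of the energy need not be measurable on the product and Tonelli's
  theorem does not apply. Instead the part of \<open>G\<close> at word distance \<open>k\<close> from \<open>w\<close> carries a finite
  measure that depends measurably on \<open>w\<close>, and the inner integral is a series of integrals
  against these kernels.\<close>

lemma borel_measurable_weighted_haar_integral:
  fixes \<mu> :: "'g::{topological_group_add,t2_space} measure" and F :: "'g \<Rightarrow> 'g \<Rightarrow> ennreal"
  assumes \<mu>: "haar_measure \<mu>" and K: "compact_generating_set K"
    and F[measurable]: "(\<lambda>(w, g). F w g) \<in> borel_measurable (borel \<Otimes>\<^sub>M borel)"
  shows "(\<lambda>w. \<integral>\<^sup>+g. ennreal (energy_weight K (- w + g)) * F w g \<partial>\<mu>) \<in> borel_measurable borel"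
proof -
  have sets[measurable_cong]: "sets \<mu> = sets borel" by (rule haar_sets[OF \<mu>])
  \<comment> \<open>With the strict inequality \<open>B 0\<close> is empty, and the sphere \<open>W n\<close> is a difference of balls
    for \<open>n = 0\<close> too.\<close>
  define B where "B n = {g. word_length K g < n}" for n
  have compB: "compact (B n)" for n
  proof (cases n)
    case (Suc m)
    then show ?thesis using compact_word_length_ball[OF K, of m] by (simp add: B_def less_Suc_eq_le)
  qed (simp add: B_def)
  have [measurable]: "B n \<in> sets borel" for n
    using compB by (intro borel_closed compact_imp_closed)
  define W where "W n = B (Suc n) - B n" for n
  have W_iff: "g \<in> W n \<longleftrightarrow> word_length K g = n" for g n by (auto simp: W_def B_def)
  have [measurable]: "W n \<in> sets borel" for n unfolding W_def by measurable
  have translate: "(\<lambda>w. emeasure \<mu> {g \<in> A. - w + g \<in> W n}) \<in> borel_measurable borel"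
    if [measurable]: "A \<in> sets borel" for A n
  proof -
    have "emeasure \<mu> {g \<in> A. - w + g \<in> W n}
        = emeasure \<mu> {g \<in> A. - w + g \<in> B (Suc n)} - emeasure \<mu> {g \<in> A. - w + g \<in> B n}" for w
    proof -
      have meas: "{g \<in> A. - w + g \<in> B n} \<in> sets \<mu>" "{g \<in> A. - w + g \<in> B (Suc n)} \<in> sets \<mu>"
        unfolding sets by measurable
      have "emeasure \<mu> {g \<in> A. - w + g \<in> B n} \<le> emeasure \<mu> ((\<lambda>g. - w + g) -` B n)"
        using measurable_sets_borel[OF measurable_translation, of "B n" "- w"]
        by (intro emeasure_mono) (auto simp: sets)
      also have "\<dots> = emeasure \<mu> (B n)" by (rule haar_translation_vimage[OF \<mu>]) simp
      also have "\<dots> < \<infinity>" by (rule haar_compact_finite[OF \<mu> compB])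
      finally have "emeasure \<mu> {g \<in> A. - w + g \<in> B n} \<noteq> \<infinity>" by simp
      moreover have "{g \<in> A. - w + g \<in> B n} \<subseteq> {g \<in> A. - w + g \<in> B (Suc n)}" by (auto simp: B_def)
      ultimately have "emeasure \<mu> ({g \<in> A. - w + g \<in> B (Suc n)} - {g \<in> A. - w + g \<in> B n})
        = emeasure \<mu> {g \<in> A. - w + g \<in> B (Suc n)} - emeasure \<mu> {g \<in> A. - w + g \<in> B n}"
        using meas by (intro emeasure_Diff)
      moreover have "{g \<in> A. - w + g \<in> B (Suc n)} - {g \<in> A. - w + g \<in> B n} = {g \<in> A. - w + g \<in> W n}"
        by (auto simp: W_def)
      ultimately show ?thesis by simp
    qed
    moreover have "(\<lambda>w. emeasure \<mu> {g \<in> A. - w + g \<in> B (Suc n)} - emeasure \<mu> {g \<in> A. - w + g \<in> B n})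
        \<in> borel_measurable borel"
      by (intro borel_measurable_minus_ennreal borel_measurable_haar_compact_translate[OF \<mu>] compB that)
    ultimately show ?thesis by simp
  qed
  define c where "c n = 1 + emeasure \<mu> (W n)" for n
  have Wfin: "emeasure \<mu> (W n) < \<infinity>" for n
  proof -
    have "emeasure \<mu> (W n) \<le> emeasure \<mu> (B (Suc n))" by (intro emeasure_mono) (auto simp: W_def sets)
    also have "\<dots> < \<infinity>" by (rule haar_compact_finite[OF \<mu> compB])
    finally show ?thesis .
  qed
  have c: "c n \<noteq> 0" "c n \<noteq> \<infinity>" for n using Wfin[of n] by (auto simp: c_def)
  \<comment> \<open>Normalizing by \<open>1 + emeasure \<mu> (W n)\<close> makes the kernel subprobabilistic without
    a case distinction on the measure of \<open>W n\<close> being zero.\<close>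
  define q where "q n = inverse (c n)" for n
  have cq: "c n * q n = 1" for n unfolding q_def using c[of n]
    by (simp add: ennreal_divide_self less_top flip: divide_ennreal_def)
  define L where "L n w = density \<mu> (\<lambda>g. q n * indicator (W n) (- w + g))" for n w
  have L_emeasure: "emeasure (L n w) A = q n * emeasure \<mu> {g \<in> A. - w + g \<in> W n}"
    if [measurable]: "A \<in> sets borel" for n w A
  proof -
    have "emeasure (L n w) A = (\<integral>\<^sup>+g. q n * indicator (W n) (- w + g) * indicator A g \<partial>\<mu>)"
      unfolding L_def by (rule emeasure_density) measurable
    also have "\<dots> = (\<integral>\<^sup>+g. q n * indicator {g \<in> A. - w + g \<in> W n} g \<partial>\<mu>)"
      by (intro nn_integral_cong) (auto simp: indicator_def)
    also have "\<dots> = q n * (\<integral>\<^sup>+g. indicator {g \<in> A. - w + g \<in> W n} g \<partial>\<mu>)"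
      by (rule nn_integral_cmult) measurable
    also have "(\<integral>\<^sup>+g. indicator {g \<in> A. - w + g \<in> W n} g \<partial>\<mu>) = emeasure \<mu> {g \<in> A. - w + g \<in> W n}"
      by (rule nn_integral_indicator) (unfold sets, measurable)
    finally show ?thesis .
  qed
  have L_kernel: "L n \<in> measurable borel (subprob_algebra borel)" for n
  proof (rule measurable_subprob_algebra)
    fix w :: 'g
    have "emeasure (L n w) UNIV = q n * emeasure \<mu> ((\<lambda>g. - w + g) -` W n)"
      using L_emeasure[of UNIV n w] by (simp add: vimage_def)
    also have "\<dots> = q n * emeasure \<mu> (W n)" by (subst haar_translation_vimage[OF \<mu>]) simp_all
    also have "\<dots> \<le> q n * c n" by (intro mult_left_mono) (simp_all add: c_def)
    also have "\<dots> = 1" using cq by (simp add: mult.commute)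
    finally have le1: "emeasure (L n w) UNIV \<le> 1" .
    have sp: "space (L n w) = UNIV" using sets_eq_imp_space_eq[OF sets] by (simp add: L_def)
    show "subprob_space (L n w)" using le1 sp by (intro subprob_spaceI) auto
    show "sets (L n w) = sets borel" by (simp add: L_def sets)
  next
    fix A :: "'g set" assume A: "A \<in> sets borel"
    show "(\<lambda>w. emeasure (L n w) A) \<in> borel_measurable borel"
      unfolding L_emeasure[OF A] using translate[OF A] by measurable
  qed
  have "(\<integral>\<^sup>+g. ennreal (energy_weight K (- w + g)) * F w g \<partial>\<mu>)
      = (\<Sum>n. ennreal (exp (- (real n)\<^sup>2 + 1)) * (c n * (\<integral>\<^sup>+g. F w g \<partial>L n w)))" for w
  proof -
    have [measurable]: "(\<lambda>g. F w g) \<in> borel_measurable borel"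
      using measurable_compose[OF measurable_Pair1' F, of w] by simp
    have pieces: "ennreal (energy_weight K h) = (\<Sum>n. ennreal (exp (- (real n)\<^sup>2 + 1)) * indicator (W n) h)" for h
    proof -
      have "(\<Sum>n. ennreal (exp (- (real n)\<^sup>2 + 1)) * indicator (W n) h)
          = (\<Sum>n\<in>{word_length K h}. ennreal (exp (- (real n)\<^sup>2 + 1)) * indicator (W n) h)"
        by (rule suminf_finite) (auto simp: W_iff)
      then show ?thesis by (simp add: W_iff energy_weight_def)
    qed
    have "(\<integral>\<^sup>+g. ennreal (energy_weight K (- w + g)) * F w g \<partial>\<mu>)
        = (\<integral>\<^sup>+g. (\<Sum>n. ennreal (exp (- (real n)\<^sup>2 + 1)) * (indicator (W n) (- w + g) * F w g)) \<partial>\<mu>)"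
      by (simp add: pieces mult.assoc flip: ennreal_suminf_multc)
    also have "\<dots> = (\<Sum>n. \<integral>\<^sup>+g. ennreal (exp (- (real n)\<^sup>2 + 1)) * (indicator (W n) (- w + g) * F w g) \<partial>\<mu>)"
      by (rule nn_integral_suminf) measurable
    also have "\<dots> = (\<Sum>n. ennreal (exp (- (real n)\<^sup>2 + 1)) * (c n * (\<integral>\<^sup>+g. F w g \<partial>L n w)))"
    proof (intro suminf_cong)
      fix n
      have "(\<integral>\<^sup>+g. F w g \<partial>L n w) = (\<integral>\<^sup>+g. q n * indicator (W n) (- w + g) * F w g \<partial>\<mu>)"
        unfolding L_def by (rule nn_integral_density) measurable
      then have "c n * (\<integral>\<^sup>+g. F w g \<partial>L n w) = (\<integral>\<^sup>+g. c n * (q n * indicator (W n) (- w + g) * F w g) \<partial>\<mu>)"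
        by (simp add: nn_integral_cmult)
      also have "\<dots> = (\<integral>\<^sup>+g. indicator (W n) (- w + g) * F w g \<partial>\<mu>)"
        by (simp only: mult.assoc[symmetric] cq mult_1_left)
      finally have "c n * (\<integral>\<^sup>+g. F w g \<partial>L n w) = (\<integral>\<^sup>+g. indicator (W n) (- w + g) * F w g \<partial>\<mu>)" .
      then show "(\<integral>\<^sup>+g. ennreal (exp (- (real n)\<^sup>2 + 1)) * (indicator (W n) (- w + g) * F w g) \<partial>\<mu>)
          = ennreal (exp (- (real n)\<^sup>2 + 1)) * (c n * (\<integral>\<^sup>+g. F w g \<partial>L n w))"
        by (simp add: nn_integral_cmult)
    qed
    finally show ?thesis .
  qed
  moreover have "(\<lambda>w. \<integral>\<^sup>+g. F w g \<partial>L n w) \<in> borel_measurable borel" for n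
    by (rule nn_integral_measurable_subprob_algebra2[OF F L_kernel])
  then have "(\<lambda>w. \<Sum>n. ennreal (exp (- (real n)\<^sup>2 + 1)) * (c n * (\<integral>\<^sup>+g. F w g \<partial>L n w)))
      \<in> borel_measurable borel"
    by measurable
  ultimately show ?thesis by simp
qed

section \<open>Displacement of finitely generated groups\<close>

lemma countable_finitely_generated_subgroup:
  fixes S :: "'g::group_add set"
  assumes "finite S"
  shows "countable (is_subgroup hull S)"
proof -
  define T where "T = sum_list ` lists (S \<union> uminus ` S)"
  have minus: "- sum_list xs \<in> T" if "xs \<in> lists (S \<union> uminus ` S)" for xs
  proof -
    have "- sum_list xs = sum_list (rev (map uminus xs))"
      by (induction xs) (simp_all add: minus_add)
    moreover have "rev (map uminus xs) \<in> lists (S \<union> uminus ` S)"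
      using that by (auto simp: in_lists_conv_set)
    ultimately show ?thesis unfolding T_def by blast
  qed
  have plus: "sum_list xs + sum_list ys \<in> T"
    if "xs \<in> lists (S \<union> uminus ` S)" "ys \<in> lists (S \<union> uminus ` S)" for xs ys
  proof -
    have "sum_list xs + sum_list ys = sum_list (xs @ ys)" by simp
    moreover have "xs @ ys \<in> lists (S \<union> uminus ` S)" using that by simp
    ultimately show ?thesis unfolding T_def by blast
  qed
  have zero: "0 \<in> T" unfolding T_def by (rule image_eqI[of _ _ "[]"]) simp_all
  have "is_subgroup T"
    unfolding is_subgroup_def using zero plus minus by (auto simp: T_def)
  moreover have "S \<subseteq> T"
  proof
    fix s assume "s \<in> S"
    then show "s \<in> T" unfolding T_def by (intro image_eqI[of _ _ "[s]"]) simp_all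
  qed
  ultimately have "is_subgroup hull S \<subseteq> T" by (intro hull_minimal)
  moreover have "countable T"
    unfolding T_def using assms by (intro countable_image countable_lists) (auto intro: countable_finite)
  ultimately show ?thesis using countable_subset by blast
qed

lemma displacement_nonneg: "finite S \<Longrightarrow> 0 \<le> displacement act S x"
  unfolding displacement_def by (intro Max_ge) auto

lemma dist_le_displacement: "finite S \<Longrightarrow> \<sigma> \<in> S \<Longrightarrow> dist (act \<sigma> x) x \<le> displacement act S x"
  unfolding displacement_def by (intro Max_ge) auto

lemma displacement_convex:
  fixes c :: "real \<Rightarrow> 'x::complete_space"
  assumes b: "bnpc TYPE('x)" and S: "finite S"
    and iso: "\<And>\<sigma> x y. \<sigma> \<in> S \<Longrightarrow> dist (act \<sigma> x) (act \<sigma> y) = dist x y"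
    and c: "geodesic c" and t: "t \<in> {0..1}"
  shows "displacement act S (c t) \<le> (1 - t) * displacement act S (c 0) + t * displacement act S (c 1)"
proof -
  let ?r = "(1 - t) * displacement act S (c 0) + t * displacement act S (c 1)"
  have "dist (act \<sigma> (c t)) (c t) \<le> ?r" if "\<sigma> \<in> S" for \<sigma>
  proof -
    have "geodesic (\<lambda>s. act \<sigma> (c s))" using c unfolding geodesic_def iso[OF that] .
    from bnpc_convex_dist[OF b this c t]
    have "dist (act \<sigma> (c t)) (c t) \<le> (1 - t) * dist (act \<sigma> (c 0)) (c 0) + t * dist (act \<sigma> (c 1)) (c 1)" .
    also have "\<dots> \<le> ?r"
      using t by (intro add_mono mult_left_mono dist_le_displacement S that) auto
    finally show ?thesis .
  qed
  moreover have "0 \<le> ?r" using t displacement_nonneg[OF S] by (intro add_nonneg_nonneg mult_nonneg_nonneg) auto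
  ultimately show ?thesis
    unfolding displacement_def[of act S "c t"] using S by (intro Max.boundedI) auto
qed

text \<open>A convex function that exceeds its value at \<open>x\<^sub>0\<close> by \<open>1\<close> on a sphere around \<open>x\<^sub>0\<close> grows at
  least linearly along the geodesics that start at \<open>x\<^sub>0\<close>.\<close>

lemma displacement_linear_growth:
  fixes x\<^sub>0 :: "'x::complete_space"
  assumes b: "bnpc TYPE('x)" and S: "finite S"
    and iso: "\<And>\<sigma> x y. \<sigma> \<in> S \<Longrightarrow> dist (act \<sigma> x) (act \<sigma> y) = dist x y"
    and infty: "\<forall>M. \<exists>a R. \<forall>x. x \<notin> cball a R \<longrightarrow> displacement act S x \<ge> M"
  obtains R where "R \<ge> 0" "\<And>x. dist x x\<^sub>0 \<le> R * (1 + displacement act S x)"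
proof -
  let ?D = "displacement act S"
  obtain a R' where R': "\<And>x. x \<notin> cball a R' \<Longrightarrow> ?D x \<ge> ?D x\<^sub>0 + 1"
    using infty[rule_format, of "?D x\<^sub>0 + 1"] by blast
  define R where "R = max 0 (R' + dist a x\<^sub>0) + 1"
  have R1: "R \<ge> 1" by (simp add: R_def)
  have far: "?D x \<ge> ?D x\<^sub>0 + 1" if "dist x x\<^sub>0 \<ge> R" for x
  proof (rule R')
    have "dist x x\<^sub>0 \<le> dist a x + dist a x\<^sub>0" by (metis dist_commute dist_triangle)
    then show "x \<notin> cball a R'" using that by (simp add: R_def)
  qed
  show ?thesis
  proof (rule that[of R])
    show "R \<ge> 0" using R1 by simp
    fix x
    show "dist x x\<^sub>0 \<le> R * (1 + ?D x)"
    proof (cases "dist x x\<^sub>0 \<le> R")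
      case True
      also have "R * 1 \<le> R * (1 + ?D x)"
        using R1 displacement_nonneg[OF S, of act x] by (intro mult_left_mono) auto
      finally show ?thesis by simp
    next
      case False
      define l where "l = dist x\<^sub>0 x"
      have l: "l > R" using False by (simp add: l_def dist_commute)
      define t where "t = R / l"
      have t: "0 < t" "t < 1" using l R1 by (auto simp: t_def)
      obtain c where c: "geodesic c" "c 0 = x\<^sub>0" "c 1 = x" using bnpc_geodesic_exists[OF b] .
      have tt: "t \<in> {0..1}" using t by simp
      have "dist (c 0) (c t) = dist (c 0) (c 1) * \<bar>0 - t\<bar>"
        using c(1) tt unfolding geodesic_def by (meson atLeastAtMost_iff order_refl zero_le_one)
      then have "dist (c t) x\<^sub>0 = l * t" using t c(2,3) by (simp add: dist_commute l_def)
      also have "\<dots> = R" using l R1 by (simp add: t_def)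
      finally have "?D x\<^sub>0 + 1 \<le> ?D (c t)" using far by simp
      also have "\<dots> \<le> (1 - t) * ?D (c 0) + t * ?D (c 1)"
        by (rule displacement_convex[OF b S iso c(1) tt])
      finally have "1 + t * ?D x\<^sub>0 \<le> t * ?D x" by (simp add: c(2,3) algebra_simps)
      moreover have "0 \<le> t * ?D x\<^sub>0" using t displacement_nonneg[OF S] by (intro mult_nonneg_nonneg) auto
      ultimately have "1 \<le> t * ?D x" by linarith
      then have "l * 1 \<le> l * (t * ?D x)" using l R1 by (intro mult_left_mono) auto
      also have "\<dots> = R * ?D x" using l R1 by (simp add: t_def)
      also have "\<dots> \<le> R * (1 + ?D x)" using R1 by (intro mult_left_mono) auto
      finally show ?thesis by (simp add: l_def dist_commute)
    qed
  qed
qed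

section \<open>Equivariant maps\<close>

locale equivariant_maps =
  fixes K \<Gamma> \<Omega> :: "'g::{topological_group_add,t2_space} set"
    and act :: "'g \<Rightarrow> 'x::complete_space \<Rightarrow> 'x"
    and \<mu> :: "'g measure" and x\<^sub>0 :: 'x
  assumes lc: "locally_compact_space (euclidean :: 'g topology)"
    and K: "compact_generating_set K"
    and haar: "haar_measure \<mu>"
    and bnpc: "bnpc TYPE('x)"
    and uconv: "uniformly_convex TYPE('x)"
    and \<Gamma>: "is_subgroup \<Gamma>" "countable \<Gamma>"
    and \<Omega>: "rel_compact_fundamental_domain \<Gamma> \<Omega>"
    and action: "isometric_action \<Gamma> act"
    and displ: "displacement_to_infinity act \<Gamma>"
begin

lemma sets_\<mu> [measurable_cong]: "sets \<mu> = sets borel"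
  by (rule haar_sets[OF haar])

lemma space_\<mu> [simp]: "space \<mu> = UNIV"
  using sets_eq_imp_space_eq[OF sets_\<mu>] by simp

lemma \<Omega>_borel [measurable]: "\<Omega> \<in> sets borel"
  using \<Omega> by (simp add: rel_compact_fundamental_domain_def)

lemma \<Omega>_compact: "compact (closure \<Omega>)"
  using \<Omega> by (simp add: rel_compact_fundamental_domain_def)

lemma zero_\<Gamma>: "0 \<in> \<Gamma>" and add_\<Gamma>: "a \<in> \<Gamma> \<Longrightarrow> b \<in> \<Gamma> \<Longrightarrow> a + b \<in> \<Gamma>" and minus_\<Gamma>: "a \<in> \<Gamma> \<Longrightarrow> - a \<in> \<Gamma>"
  using \<Gamma>(1) by (auto simp: is_subgroup_def)

lemma act_zero: "act 0 x = x"
  and act_add: "a \<in> \<Gamma> \<Longrightarrow> b \<in> \<Gamma> \<Longrightarrow> act (a + b) x = act a (act b x)"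
  and act_isometry: "a \<in> \<Gamma> \<Longrightarrow> dist (act a x) (act a y) = dist x y"
  using action unfolding isometric_action_def by blast+

lemma continuous_act: "a \<in> \<Gamma> \<Longrightarrow> continuous_on A (act a)"
  unfolding continuous_on_iff using act_isometry by metis

lemma translate_borel: "A \<in> sets borel \<Longrightarrow> (+) a ` A \<in> sets borel" for a :: 'g
  using measurable_sets_borel[OF measurable_translation] by (simp only: translation_image)

definition tile :: "'g \<Rightarrow> 'g" where
  "tile g = (THE \<gamma>. \<gamma> \<in> \<Gamma> \<and> g \<in> (+) \<gamma> ` \<Omega>)"

lemma tile_eqI:
  assumes "\<gamma> \<in> \<Gamma>" "g \<in> (+) \<gamma> ` \<Omega>"
  shows "tile g = \<gamma>"
  unfolding tile_def
proof (rule the_equality)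
  fix \<gamma>' assume *: "\<gamma>' \<in> \<Gamma> \<and> g \<in> (+) \<gamma>' ` \<Omega>"
  have "disjoint_family_on (\<lambda>\<gamma>. (+) \<gamma> ` \<Omega>) \<Gamma>"
    using \<Omega> by (simp add: rel_compact_fundamental_domain_def)
  with * assms show "\<gamma>' = \<gamma>" unfolding disjoint_family_on_def by blast
qed (use assms in simp)

lemma tile: "tile g \<in> \<Gamma>" "g \<in> (+) (tile g) ` \<Omega>"
proof -
  have "(\<Union>\<gamma>\<in>\<Gamma>. (+) \<gamma> ` \<Omega>) = UNIV" using \<Omega> by (simp add: rel_compact_fundamental_domain_def)
  then have "g \<in> (\<Union>\<gamma>\<in>\<Gamma>. (+) \<gamma> ` \<Omega>)" by simp
  then obtain \<gamma> where g: "\<gamma> \<in> \<Gamma>" "g \<in> (+) \<gamma> ` \<Omega>" by (rule UN_E)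
  with tile_eqI[OF g] show "tile g \<in> \<Gamma>" "g \<in> (+) (tile g) ` \<Omega>" by simp_all
qed

lemma tile_add: "a \<in> \<Gamma> \<Longrightarrow> tile (a + g) = a + tile g"
proof (rule tile_eqI)
  assume a: "a \<in> \<Gamma>"
  show "a + tile g \<in> \<Gamma>" by (intro add_\<Gamma> a tile)
  show "a + g \<in> (+) (a + tile g) ` \<Omega>" using tile(2)[of g] by (auto simp: add.assoc)
qed

lemma tile_\<Omega>: "g \<in> \<Omega> \<Longrightarrow> tile g = 0"
  by (rule tile_eqI) (auto simp: zero_\<Gamma>)

definition orbit_map :: "'g \<Rightarrow> 'x" where
  "orbit_map g = act (tile g) x\<^sub>0"

definition equivariant :: "('g \<Rightarrow> 'x) \<Rightarrow> bool" where
  "equivariant \<phi> \<longleftrightarrow> (\<forall>\<gamma>\<in>\<Gamma>. \<forall>g. \<phi> (\<gamma> + g) = act \<gamma> (\<phi> g))"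

text \<open>The maps of this class are separably valued at every point, not only almost everywhere. This
  makes their pointwise distances and midpoints measurable.\<close>

definition separable_maps :: "('g \<Rightarrow> 'x) set" where
  "separable_maps = {\<phi> \<in> borel_measurable borel. equivariant \<phi> \<and> (\<exists>D. countable D \<and> range \<phi> \<subseteq> closure D)}"

lemma equivariant_dist:
  assumes "equivariant \<phi>" "equivariant \<psi>" "\<gamma> \<in> \<Gamma>"
  shows "dist (\<phi> (\<gamma> + g)) (\<psi> (\<gamma> + h)) = dist (\<phi> g) (\<psi> h)"
  using assms by (simp add: equivariant_def act_isometry)

lemma orbit_map_measurable: "orbit_map \<in> borel_measurable borel"
proof -
  have "tile \<in> measurable borel (count_space \<Gamma>)"
    unfolding measurable_count_space_eq_countable[OF \<Gamma>(2)]
  proof (intro conjI ballI)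
    fix a assume "a \<in> \<Gamma>"
    then have "tile -` {a} = (+) a ` \<Omega>" using tile(2) tile_eqI by auto
    then show "tile -` {a} \<inter> space borel \<in> sets borel" by (simp add: translate_borel)
  qed (use tile in auto)
  from measurable_compose_countable'[OF _ this \<Gamma>(2), of "\<lambda>\<gamma> _. act \<gamma> x\<^sub>0"]
  show ?thesis unfolding orbit_map_def[abs_def] by simp
qed

lemma orbit_map_equivariant: "equivariant orbit_map"
  unfolding equivariant_def orbit_map_def by (simp add: tile_add act_add tile)

lemma orbit_map_\<Omega>: "g \<in> \<Omega> \<Longrightarrow> orbit_map g = x\<^sub>0"
  by (simp add: orbit_map_def tile_\<Omega> act_zero)

text \<open>The orbit map is defined everywhere and equivariant, so it can replace the values of another
  equivariant map on any invariant set where these are missing or unwanted.\<close>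

lemma modification_separable:
  assumes \<phi>[measurable]: "\<phi> \<in> borel_measurable borel" and "equivariant \<phi>"
    and A[measurable]: "A \<in> sets borel" and inv: "\<And>\<gamma> g. \<gamma> \<in> \<Gamma> \<Longrightarrow> \<gamma> + g \<in> A \<longleftrightarrow> g \<in> A"
    and D: "countable D" "\<And>g. g \<in> A \<Longrightarrow> \<phi> g \<in> closure D"
  shows "(\<lambda>g. if g \<in> A then \<phi> g else orbit_map g) \<in> separable_maps"
  unfolding separable_maps_def
proof (intro CollectI conjI exI)
  note orbit_map_measurable[measurable]
  show "(\<lambda>g. if g \<in> A then \<phi> g else orbit_map g) \<in> borel_measurable borel" by measurable
  show "equivariant (\<lambda>g. if g \<in> A then \<phi> g else orbit_map g)"
    using assms(2) orbit_map_equivariant by (simp add: equivariant_def inv)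
  let ?D = "D \<union> (\<lambda>\<gamma>. act \<gamma> x\<^sub>0) ` \<Gamma>"
  show "countable ?D" using D(1) \<Gamma>(2) by simp
  have "closure D \<subseteq> closure ?D" by (intro closure_mono) auto
  moreover have "orbit_map g \<in> closure ?D" for g
    using tile(1)[of g] closure_subset[of ?D] by (auto simp: orbit_map_def)
  ultimately show "range (\<lambda>g. if g \<in> A then \<phi> g else orbit_map g) \<subseteq> closure ?D" using D(2) by auto
qed

lemma orbit_map_separable: "orbit_map \<in> separable_maps"
  using modification_separable[OF orbit_map_measurable orbit_map_equivariant, of "{}" "{}"] by simp

lemma AE_from_fundamental_domain:
  assumes A[measurable]: "A \<in> sets borel" and inv: "\<And>\<gamma> g. \<gamma> \<in> \<Gamma> \<Longrightarrow> \<gamma> + g \<in> A \<longleftrightarrow> g \<in> A"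
    and ae: "AE g in \<mu>. g \<in> \<Omega> \<longrightarrow> g \<in> A"
  shows "AE g in \<mu>. g \<in> A"
proof -
  let ?B = "\<Omega> - A"
  have B: "?B \<in> sets borel" by measurable
  have "?B \<in> null_sets \<mu>"
  proof -
    have "{g \<in> space \<mu>. \<not> (g \<in> \<Omega> \<longrightarrow> g \<in> A)} = ?B" by auto
    with AE_iff_null_sets[of ?B \<mu>] B ae show ?thesis by (simp add: sets_\<mu>)
  qed
  then have "(+) \<gamma> ` ?B \<in> null_sets \<mu>" for \<gamma>
    using haar_image[OF haar B, of \<gamma>] translate_borel[OF B, of \<gamma>] by (auto simp: null_sets_def sets_\<mu>)
  then have null: "(\<Union>\<gamma>\<in>\<Gamma>. (+) \<gamma> ` ?B) \<in> null_sets \<mu>" using \<Gamma>(2) by (intro null_sets_UN')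
  have "g \<in> (\<Union>\<gamma>\<in>\<Gamma>. (+) \<gamma> ` ?B)" if "g \<notin> A" for g
  proof -
    obtain w where w: "w \<in> \<Omega>" "g = tile g + w" using tile(2)[of g] by auto
    have "w \<notin> A" using that inv[OF tile(1)[of g], of w] w(2) by simp
    then show ?thesis using tile(1)[of g] w by blast
  qed
  then show ?thesis by (intro AE_I'[OF null]) auto
qed

text \<open>If almost all values lie in the closure of \<open>D\<close>, then the values in the closure of the countable
  set \<open>\<Gamma> D\<close> are attained on an invariant Borel set of full measure.\<close>

lemma L2_equivalent_separable:
  assumes "\<psi> \<in> L2_equivariant act \<Gamma> \<mu> \<Omega> x\<^sub>0"
  obtains \<psi>' where "\<psi>' \<in> separable_maps" "AE g in \<mu>. \<psi>' g = \<psi> g"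
proof -
  have \<psi>: "\<psi> \<in> borel_measurable \<mu>" "equivariant \<psi>" "\<exists>D. countable D \<and> (AE g in \<mu>. \<psi> g \<in> closure D)"
    using assms by (auto simp: L2_equivariant_def equivariant_def)
  from \<psi>(3) obtain D where D: "countable D" "AE g in \<mu>. \<psi> g \<in> closure D" by blast
  have \<psi>b: "\<psi> \<in> borel_measurable borel"
    using \<psi>(1) by (simp add: measurable_cong_sets[OF sets_\<mu> refl])
  define E where "E = (\<Union>\<gamma>\<in>\<Gamma>. act \<gamma> ` D)"
  define A where "A = \<psi> -` closure E"
  have E_inv: "act \<gamma> ` closure E \<subseteq> closure E" if "\<gamma> \<in> \<Gamma>" for \<gamma>
  proof (rule image_closure_subset[OF continuous_act[OF that] closed_closure])
    have "act \<gamma> ` E \<subseteq> E" unfolding E_def using that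
      by (force simp: act_add[symmetric] intro: add_\<Gamma>)
    then show "act \<gamma> ` E \<subseteq> closure E" using closure_subset by blast
  qed
  have A_imp: "\<gamma> + g \<in> A" if "\<gamma> \<in> \<Gamma>" "g \<in> A" for \<gamma> g
    using that E_inv[of \<gamma>] \<psi>(2) by (auto simp: A_def equivariant_def)
  have inv: "\<gamma> + g \<in> A \<longleftrightarrow> g \<in> A" if "\<gamma> \<in> \<Gamma>" for \<gamma> g
    using A_imp[OF that] A_imp[OF minus_\<Gamma>[OF that], of "\<gamma> + g"] by auto
  show ?thesis
  proof (rule that)
    show "(\<lambda>g. if g \<in> A then \<psi> g else orbit_map g) \<in> separable_maps"
    proof (rule modification_separable[OF \<psi>b \<psi>(2) _ inv])
      show "A \<in> sets borel" unfolding A_def by (rule measurable_sets_borel[OF \<psi>b]) simp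
      show "countable E" unfolding E_def using D(1) \<Gamma>(2) by simp
    qed (auto simp: A_def)
    have "act 0 ` D \<subseteq> E" unfolding E_def using zero_\<Gamma> by (rule UN_upper)
    then have "D \<subseteq> E" by (simp add: act_zero)
    then have "closure D \<subseteq> closure E" by (rule closure_mono)
    with D(2) show "AE g in \<mu>. (if g \<in> A then \<psi> g else orbit_map g) = \<psi> g"
      by (auto simp: A_def elim!: eventually_mono)
  qed
qed

definition inner_energy :: "('g \<Rightarrow> 'x) \<Rightarrow> 'g \<Rightarrow> ennreal" where
  "inner_energy \<phi> w = (\<integral>\<^sup>+g. ennreal (energy_weight K (- w + g) * (dist (\<phi> w) (\<phi> g))\<^sup>2) \<partial>\<mu>)"

definition total_energy :: "('g \<Rightarrow> 'x) \<Rightarrow> ennreal" where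
  "total_energy \<phi> = (\<integral>\<^sup>+w\<in>\<Omega>. inner_energy \<phi> w \<partial>\<mu>)"

definition sq_norm :: "('g \<Rightarrow> 'x) \<Rightarrow> ennreal" where
  "sq_norm \<phi> = (\<integral>\<^sup>+w\<in>\<Omega>. ennreal ((dist (\<phi> w) x\<^sub>0)\<^sup>2) \<partial>\<mu>)"

lemma energy_eq: "energy K \<mu> \<Omega> \<phi> = total_energy \<phi> / emeasure \<mu> \<Omega>"
  by (simp add: energy_def total_energy_def inner_energy_def)

lemma energy_weight_nonneg: "0 \<le> energy_weight K g"
  by (simp add: energy_weight_def)

lemma measurable_dist [measurable]:
  assumes "\<phi> \<in> separable_maps" "\<psi> \<in> borel_measurable borel"
  shows "(\<lambda>g. dist (\<phi> g) (\<psi> g)) \<in> borel_measurable borel"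
  using assms unfolding separable_maps_def
  by (auto intro!: borel_measurable_dist_separable)

lemma separable_maps_measurable: "\<phi> \<in> separable_maps \<Longrightarrow> \<phi> \<in> borel_measurable borel"
  by (simp add: separable_maps_def)

lemma separable_maps_equivariant: "\<phi> \<in> separable_maps \<Longrightarrow> equivariant \<phi>"
  by (simp add: separable_maps_def)

lemma inner_energy_measurable:
  assumes "\<phi> \<in> separable_maps"
  shows "inner_energy \<phi> \<in> borel_measurable borel"
proof -
  obtain D where D: "countable D" "range \<phi> \<subseteq> closure D" and [measurable]: "\<phi> \<in> borel_measurable borel"
    using assms by (auto simp: separable_maps_def)
  have "(\<lambda>p. dist (\<phi> (fst p)) (\<phi> (snd p))) \<in> borel_measurable (borel \<Otimes>\<^sub>M borel)"
    by (rule borel_measurable_dist_separable[OF _ _ D(1)]) (use D(2) in auto)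
  then have "(\<lambda>(w, g). ennreal ((dist (\<phi> w) (\<phi> g))\<^sup>2)) \<in> borel_measurable (borel \<Otimes>\<^sub>M borel)"
    unfolding case_prod_beta by measurable
  from borel_measurable_weighted_haar_integral[OF haar K this]
  show ?thesis unfolding inner_energy_def[abs_def] by (simp add: ennreal_mult energy_weight_nonneg)
qed

lemma integrand_measurable:
  assumes "\<phi> \<in> borel_measurable borel"
  shows "(\<lambda>g. ennreal (energy_weight K (- w + g) * (dist x (\<phi> g))\<^sup>2)) \<in> borel_measurable \<mu>"
proof -
  note borel_measurable_energy_weight[OF K, measurable]
  have [measurable]: "(\<lambda>g. dist x (\<phi> g)) \<in> borel_measurable borel"
    by (rule measurable_compose[OF assms]) (intro borel_measurable_continuous_onI continuous_intros)
  have [measurable]: "(\<lambda>g. energy_weight K (- w + g)) \<in> borel_measurable borel"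
    by (rule measurable_compose[OF measurable_translation]) measurable
  show ?thesis by measurable
qed

lemma total_energy_cong_AE:
  assumes "AE g in \<mu>. \<phi> g = \<psi> g"
  shows "total_energy \<phi> = total_energy \<psi>"
proof -
  have "inner_energy \<phi> w = inner_energy \<psi> w" if "\<phi> w = \<psi> w" for w
    unfolding inner_energy_def by (rule nn_integral_cong_AE) (use assms that in \<open>auto elim!: eventually_mono\<close>)
  then show ?thesis
    unfolding total_energy_def by (intro nn_integral_cong_AE) (use assms in \<open>auto elim!: eventually_mono\<close>)
qed

section \<open>Convexity and coercivity of the energy\<close>

definition mid_map :: "('g \<Rightarrow> 'x) \<Rightarrow> ('g \<Rightarrow> 'x) \<Rightarrow> 'g \<Rightarrow> 'x" where
  "mid_map \<phi> \<psi> g = geo_midpoint (\<phi> g) (\<psi> g)"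

lemma mid_map_separable:
  assumes "\<phi> \<in> separable_maps" "\<psi> \<in> separable_maps"
  shows "mid_map \<phi> \<psi> \<in> separable_maps"
proof -
  obtain D where D: "countable D" "\<And>g. \<phi> g \<in> closure D" using assms(1) by (auto simp: separable_maps_def)
  obtain E where E: "countable E" "\<And>g. \<psi> g \<in> closure E" using assms(2) by (auto simp: separable_maps_def)
  note meas = separable_maps_measurable[OF assms(1)] separable_maps_measurable[OF assms(2)]
  show ?thesis
    unfolding separable_maps_def
  proof (intro CollectI conjI exI)
    show "mid_map \<phi> \<psi> \<in> borel_measurable borel"
      unfolding mid_map_def[abs_def]
      by (rule borel_measurable_continuous_separable2[OF meas(1) D meas(2) E continuous_geo_midpoint[OF bnpc]])
    show "equivariant (mid_map \<phi> \<psi>)"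
      using separable_maps_equivariant[OF assms(1)] separable_maps_equivariant[OF assms(2)]
      by (simp add: equivariant_def mid_map_def geo_midpoint_isometry[OF bnpc] act_isometry)
    show "countable ((\<lambda>p. geo_midpoint (fst p) (snd p)) ` (D \<times> E))" using D(1) E(1) by simp
    show "range (mid_map \<phi> \<psi>) \<subseteq> closure ((\<lambda>p. geo_midpoint (fst p) (snd p)) ` (D \<times> E))"
      using geo_midpoint_in_closure[OF bnpc D(2) E(2)] by (auto simp: mid_map_def)
  qed
qed

lemma inner_energy_mid_le:
  assumes "\<phi> \<in> separable_maps" "\<psi> \<in> separable_maps"
  shows "2 * inner_energy (mid_map \<phi> \<psi>) w \<le> inner_energy \<phi> w + inner_energy \<psi> w"
proof -
  note meas = separable_maps_measurable[OF assms(1)] separable_maps_measurable[OF assms(2)]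
    separable_maps_measurable[OF mid_map_separable[OF assms]]
  let ?h = "\<lambda>g. energy_weight K (- w + g)"
  let ?F = "\<lambda>\<theta> g. ?h g * (dist (\<theta> w) (\<theta> g))\<^sup>2"
  have "2 * (?h g * (dist (mid_map \<phi> \<psi> w) (mid_map \<phi> \<psi> g))\<^sup>2)
      \<le> ?h g * (dist (\<phi> w) (\<phi> g))\<^sup>2 + ?h g * (dist (\<psi> w) (\<psi> g))\<^sup>2" for g
  proof -
    let ?a = "dist (\<phi> w) (\<phi> g)" and ?b = "dist (\<psi> w) (\<psi> g)"
    have "(dist (mid_map \<phi> \<psi> w) (mid_map \<phi> \<psi> g))\<^sup>2 \<le> ((?a + ?b) / 2)\<^sup>2"
      unfolding mid_map_def by (intro power_mono dist_geo_midpoint_le bnpc) simp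
    moreover have "2 * ((?a + ?b) / 2)\<^sup>2 = ?a\<^sup>2 + ?b\<^sup>2 - (?a - ?b)\<^sup>2 / 2"
      by (simp add: power2_eq_square field_simps)
    ultimately have "2 * (dist (mid_map \<phi> \<psi> w) (mid_map \<phi> \<psi> g))\<^sup>2 \<le> ?a\<^sup>2 + ?b\<^sup>2"
      using zero_le_power2[of "?a - ?b"] by linarith
    from mult_left_mono[OF this energy_weight_nonneg[of "- w + g"]] show ?thesis
      by (simp add: algebra_simps)
  qed
  then have pt: "2 * ?F (mid_map \<phi> \<psi>) g \<le> ?F \<phi> g + ?F \<psi> g" for g .
  have nonneg: "0 \<le> ?F \<theta> g" for \<theta> g using energy_weight_nonneg by simp
  have double: "2 * ennreal p \<le> ennreal q + ennreal r" if "2 * p \<le> q + r" "0 \<le> p" "0 \<le> q" "0 \<le> r" for p q r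
  proof -
    have "2 * ennreal p = ennreal (2 * p)" using that by (subst ennreal_mult) auto
    also have "\<dots> \<le> ennreal (q + r)" using that(1) by (rule ennreal_leI)
    finally show ?thesis using that by (simp add: ennreal_plus)
  qed
  have "2 * inner_energy (mid_map \<phi> \<psi>) w = (\<integral>\<^sup>+g. 2 * ennreal (?F (mid_map \<phi> \<psi>) g) \<partial>\<mu>)"
    unfolding inner_energy_def by (intro nn_integral_cmult[symmetric] integrand_measurable meas)
  also have "\<dots> \<le> (\<integral>\<^sup>+g. ennreal (?F \<phi> g) + ennreal (?F \<psi> g) \<partial>\<mu>)"
    by (intro nn_integral_mono double pt nonneg)
  also have "\<dots> = inner_energy \<phi> w + inner_energy \<psi> w"
    unfolding inner_energy_def by (intro nn_integral_add integrand_measurable meas)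
  finally show ?thesis .
qed

lemma set_integral_measurable:
  assumes "f \<in> borel_measurable borel"
  shows "(\<lambda>w. f w * indicator \<Omega> w :: ennreal) \<in> borel_measurable \<mu>"
  using assms by measurable

lemma total_energy_mid_le:
  assumes "\<phi> \<in> separable_maps" "\<psi> \<in> separable_maps"
  shows "2 * total_energy (mid_map \<phi> \<psi>) \<le> total_energy \<phi> + total_energy \<psi>"
proof -
  note meas = set_integral_measurable[OF inner_energy_measurable]
  have "2 * total_energy (mid_map \<phi> \<psi>) = (\<integral>\<^sup>+w. 2 * (inner_energy (mid_map \<phi> \<psi>) w * indicator \<Omega> w) \<partial>\<mu>)"
    unfolding total_energy_def by (rule nn_integral_cmult[symmetric]) (intro meas mid_map_separable assms)
  also have "\<dots> \<le> (\<integral>\<^sup>+w. inner_energy \<phi> w * indicator \<Omega> w + inner_energy \<psi> w * indicator \<Omega> w \<partial>\<mu>)"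
    by (intro nn_integral_mono) (use inner_energy_mid_le[OF assms] in \<open>auto simp: indicator_def\<close>)
  also have "\<dots> = total_energy \<phi> + total_energy \<psi>"
    unfolding total_energy_def by (rule nn_integral_add) (intro meas assms)+
  finally show ?thesis .
qed

lemma inner_energy_translate:
  assumes "\<phi> \<in> borel_measurable borel" "equivariant \<phi>" "\<gamma> \<in> \<Gamma>"
  shows "inner_energy \<phi> (\<gamma> + w) = inner_energy \<phi> w"
proof -
  have "inner_energy \<phi> (\<gamma> + w)
      = (\<integral>\<^sup>+g. ennreal (energy_weight K (- (\<gamma> + w) + (\<gamma> + g)) * (dist (\<phi> (\<gamma> + w)) (\<phi> (\<gamma> + g)))\<^sup>2) \<partial>\<mu>)"
    unfolding inner_energy_def
    using integrand_measurable[OF assms(1), of "\<gamma> + w" "\<phi> (\<gamma> + w)"]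
    by (intro haar_nn_integral_translation[OF haar, symmetric]) (simp add: measurable_cong_sets[OF sets_\<mu> refl])
  moreover have "- (\<gamma> + w) + (\<gamma> + g) = - w + g" for g
    by (simp only: minus_add add.assoc minus_add_cancel)
  ultimately show ?thesis
    unfolding inner_energy_def by (simp only: equivariant_dist[OF assms(2) assms(2) assms(3)])
qed

lemma haar_positive_compact:
  obtains E where "compact E" "0 < emeasure \<mu> E" "emeasure \<mu> E < \<infinity>"
proof -
  have "0 < emeasure \<mu> UNIV" using haar_UNIV_nonzero[OF haar] by (simp add: zero_less_iff_neq_zero)
  also have "emeasure \<mu> UNIV = (SUP C\<in>{C. compact C \<and> C \<subseteq> UNIV}. emeasure \<mu> C)"
    by (rule haar_inner_regular[OF haar open_UNIV])
  finally obtain E where "compact E" "0 < emeasure \<mu> E" unfolding less_SUP_iff by blast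
  then show ?thesis using that haar_compact_finite[OF haar] by blast
qed

text \<open>The points \<open>w\<close> and \<open>\<sigma> + w\<close> both interact, with weight bounded from below, with all points
  of a fixed compact set of positive measure, and they have the same inner energy.\<close>

lemma displacement_le_inner_energy:
  assumes S: "finite S" "S \<subseteq> \<Gamma>"
  obtains A where "A \<ge> 0"
    "\<And>\<phi> w. \<phi> \<in> separable_maps \<Longrightarrow> w \<in> \<Omega> \<Longrightarrow>
      ennreal ((displacement act S (\<phi> w))\<^sup>2) \<le> ennreal A * inner_energy \<phi> w"
proof -
  obtain E where E: "compact E" "0 < emeasure \<mu> E" "emeasure \<mu> E < \<infinity>" using haar_positive_compact .
  define m where "m = measure \<mu> E"
  have m: "emeasure \<mu> E = ennreal m" unfolding m_def using E(3) by (intro emeasure_eq_ennreal_measure) auto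
  then have "m > 0" using E(2) by simp
  have E_borel: "E \<in> sets borel" using E(1) by (intro borel_closed compact_imp_closed)
  have "\<exists>n. \<forall>w\<in>\<Omega>. \<forall>g\<in>E. word_length K (- (\<sigma> + w) + g) \<le> n" for \<sigma>
  proof -
    have "compact ((\<lambda>p. - (\<sigma> + fst p) + snd p) ` (closure \<Omega> \<times> E))"
      by (intro compact_continuous_image continuous_intros compact_Times \<Omega>_compact E)
    then obtain n where n: "\<And>g. g \<in> (\<lambda>p. - (\<sigma> + fst p) + snd p) ` (closure \<Omega> \<times> E) \<Longrightarrow> word_length K g \<le> n"
      using word_length_bounded_on_compact[OF lc K] by blast
    have "word_length K (- (\<sigma> + w) + g) \<le> n" if "w \<in> \<Omega>" "g \<in> E" for w g
      using that closure_subset[of \<Omega>] by (intro n image_eqI[of _ _ "(w, g)"]) auto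
    then show ?thesis by blast
  qed
  then obtain n where n: "\<And>\<sigma> w g. w \<in> \<Omega> \<Longrightarrow> g \<in> E \<Longrightarrow> word_length K (- (\<sigma> + w) + g) \<le> n \<sigma>" by metis
  define N where "N = Max (n ` insert 0 S)"
  define c where "c = exp (- (real N)\<^sup>2 + 1)"
  have c: "c > 0" by (simp add: c_def)
  have weight: "c \<le> energy_weight K (- (\<sigma> + w) + g)" if "\<sigma> \<in> insert 0 S" "w \<in> \<Omega>" "g \<in> E" for \<sigma> w g
  proof -
    have "word_length K (- (\<sigma> + w) + g) \<le> n \<sigma>" by (rule n) (use that in auto)
    also have "\<dots> \<le> N" unfolding N_def using S(1) that(1) by (intro Max_ge) auto
    finally have "(real (word_length K (- (\<sigma> + w) + g)))\<^sup>2 \<le> (real N)\<^sup>2" by (intro power_mono) auto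
    then show ?thesis by (simp add: c_def energy_weight_def)
  qed
  define A where "A = 4 / (c * m)"
  have step: "ennreal ((dist (act \<sigma> (\<phi> w)) (\<phi> w))\<^sup>2) \<le> ennreal A * inner_energy \<phi> w"
    if \<phi>: "\<phi> \<in> separable_maps" and w: "w \<in> \<Omega>" and \<sigma>: "\<sigma> \<in> S" for \<phi> w \<sigma>
  proof -
    let ?d = "dist (act \<sigma> (\<phi> w)) (\<phi> w)"
    have \<phi>': "\<phi> \<in> borel_measurable borel" "equivariant \<phi>" using \<phi> by (auto simp: separable_maps_def)
    have \<sigma>\<Gamma>: "\<sigma> \<in> \<Gamma>" using \<sigma> S by blast
    have shift: "act \<sigma> (\<phi> w) = \<phi> (\<sigma> + w)" using \<phi>'(2) \<sigma>\<Gamma> by (simp add: equivariant_def)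
    let ?F = "\<lambda>v g. energy_weight K (- v + g) * (dist (\<phi> v) (\<phi> g))\<^sup>2"
    have pt: "c * ?d\<^sup>2 * indicator E g \<le> 2 * (?F w g + ?F (\<sigma> + w) g)" for g
    proof (cases "g \<in> E")
      case True
      let ?a = "dist (\<phi> w) (\<phi> g)" and ?b = "dist (\<phi> (\<sigma> + w)) (\<phi> g)"
      have "?d \<le> ?a + ?b" unfolding shift by (metis add.commute dist_commute dist_triangle2)
      then have "?d\<^sup>2 \<le> (?a + ?b)\<^sup>2" by (intro power_mono) auto
      also have "\<dots> = 2 * (?a\<^sup>2 + ?b\<^sup>2) - (?a - ?b)\<^sup>2" by (simp add: power2_eq_square algebra_simps)
      also have "\<dots> \<le> 2 * (?a\<^sup>2 + ?b\<^sup>2)" by simp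
      finally have "c * ?d\<^sup>2 \<le> c * (2 * (?a\<^sup>2 + ?b\<^sup>2))" using c by (intro mult_left_mono) auto
      also have "\<dots> = 2 * (c * ?a\<^sup>2 + c * ?b\<^sup>2)" by (simp add: algebra_simps)
      also have "\<dots> \<le> 2 * (?F w g + ?F (\<sigma> + w) g)"
        using weight[of 0 w g] weight[of \<sigma> w g] w \<sigma> True
        by (intro mult_left_mono add_mono mult_right_mono) auto
      finally show ?thesis using True by simp
    next
      case False
      then show ?thesis using energy_weight_nonneg by simp
    qed
    have F0: "0 \<le> ?F v g" for v g using energy_weight_nonneg by simp
    have "ennreal (c * ?d\<^sup>2) * emeasure \<mu> E = (\<integral>\<^sup>+g. ennreal (c * ?d\<^sup>2) * indicator E g \<partial>\<mu>)"
      by (rule nn_integral_cmult_indicator[symmetric]) (simp add: E_borel sets_\<mu>)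
    also have "\<dots> = (\<integral>\<^sup>+g. ennreal (c * ?d\<^sup>2 * indicator E g) \<partial>\<mu>)"
      by (intro nn_integral_cong) (auto simp: indicator_def)
    also have "\<dots> \<le> (\<integral>\<^sup>+g. ennreal (2 * (?F w g + ?F (\<sigma> + w) g)) \<partial>\<mu>)"
      by (intro nn_integral_mono ennreal_leI pt)
    also have "\<dots> = (\<integral>\<^sup>+g. 2 * (ennreal (?F w g) + ennreal (?F (\<sigma> + w) g)) \<partial>\<mu>)"
      using F0 by (simp add: ennreal_mult ennreal_plus)
    also have "\<dots> = 2 * (\<integral>\<^sup>+g. ennreal (?F w g) + ennreal (?F (\<sigma> + w) g) \<partial>\<mu>)"
      by (intro nn_integral_cmult borel_measurable_add integrand_measurable \<phi>')
    also have "\<dots> = 2 * (inner_energy \<phi> w + inner_energy \<phi> (\<sigma> + w))"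
      unfolding inner_energy_def by (subst nn_integral_add) (intro integrand_measurable \<phi>' refl)+
    also have "\<dots> = 4 * inner_energy \<phi> w"
      by (simp add: inner_energy_translate[OF \<phi>' \<sigma>\<Gamma>] flip: mult_2)
    finally have le: "ennreal (c * ?d\<^sup>2) * ennreal m \<le> 4 * inner_energy \<phi> w" unfolding m .
    have "ennreal (?d\<^sup>2) = ennreal (1 / (c * m)) * (ennreal (c * ?d\<^sup>2) * ennreal m)"
      using c \<open>m > 0\<close> by (simp flip: ennreal_mult)
    also have "\<dots> \<le> ennreal (1 / (c * m)) * (4 * inner_energy \<phi> w)"
      by (intro mult_left_mono le) simp
    also have "\<dots> = ennreal (1 / (c * m)) * ennreal 4 * inner_energy \<phi> w"
      by (simp add: mult.assoc)
    also have "ennreal (1 / (c * m)) * ennreal 4 = ennreal A"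
      using c \<open>m > 0\<close> by (subst ennreal_mult[symmetric]) (auto simp: A_def)
    finally show ?thesis .
  qed
  show ?thesis
  proof (rule that[of A])
    show "A \<ge> 0" using c \<open>m > 0\<close> by (simp add: A_def)
    fix \<phi> w assume \<phi>: "\<phi> \<in> separable_maps" "w \<in> \<Omega>"
    have "displacement act S (\<phi> w) \<in> insert 0 ((\<lambda>\<sigma>. dist (act \<sigma> (\<phi> w)) (\<phi> w)) ` S)"
      unfolding displacement_def using S(1) by (intro Max_in) auto
    then consider "displacement act S (\<phi> w) = 0"
      | \<sigma> where "\<sigma> \<in> S" "displacement act S (\<phi> w) = dist (act \<sigma> (\<phi> w)) (\<phi> w)" by blast
    then show "ennreal ((displacement act S (\<phi> w))\<^sup>2) \<le> ennreal A * inner_energy \<phi> w"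
      by cases (use step[OF \<phi>] in auto)
  qed
qed

text \<open>Coercivity: far away from \<open>x\<^sub>0\<close> the displacement is at least proportional to the distance, and
  the inner energy dominates the square of the displacement.\<close>

lemma sq_norm_le_total_energy:
  obtains A B where "A \<ge> 0" "B \<ge> 0"
    "\<And>\<phi>. \<phi> \<in> separable_maps \<Longrightarrow> sq_norm \<phi> \<le> ennreal A * total_energy \<phi> + ennreal B"
proof -
  obtain S where S: "finite S" "is_subgroup hull S = \<Gamma>"
    and infty: "\<forall>M. \<exists>a R. \<forall>x. x \<notin> cball a R \<longrightarrow> displacement act S x \<ge> M"
    using displ unfolding displacement_to_infinity_def by blast
  have S\<Gamma>: "S \<subseteq> \<Gamma>" using hull_subset[of S is_subgroup] S(2) by simp
  have iso: "dist (act \<sigma> x) (act \<sigma> y) = dist x y" if "\<sigma> \<in> S" for \<sigma> x y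
    using that S\<Gamma> by (intro act_isometry) blast
  obtain R where R: "R \<ge> 0" "\<And>x. dist x x\<^sub>0 \<le> R * (1 + displacement act S x)"
    using displacement_linear_growth[where x\<^sub>0 = x\<^sub>0, OF bnpc S(1) iso infty] by blast
  obtain A where A: "A \<ge> 0" "\<And>\<phi> w. \<phi> \<in> separable_maps \<Longrightarrow> w \<in> \<Omega> \<Longrightarrow>
      ennreal ((displacement act S (\<phi> w))\<^sup>2) \<le> ennreal A * inner_energy \<phi> w"
    using displacement_le_inner_energy[OF S(1) S\<Gamma>] by blast
  have "emeasure \<mu> \<Omega> \<le> emeasure \<mu> (closure \<Omega>)"
    by (intro emeasure_mono closure_subset) (simp add: sets_\<mu>)
  also have "\<dots> < \<infinity>" by (rule haar_compact_finite[OF haar \<Omega>_compact])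
  finally have m: "emeasure \<mu> \<Omega> = ennreal (measure \<mu> \<Omega>)" by (intro emeasure_eq_ennreal_measure) auto
  show ?thesis
  proof (rule that[of "2 * R\<^sup>2 * A" "2 * R\<^sup>2 * measure \<mu> \<Omega>"])
    show "0 \<le> 2 * R\<^sup>2 * A" "0 \<le> 2 * R\<^sup>2 * measure \<mu> \<Omega>" using A(1) by simp_all
    fix \<phi> assume \<phi>: "\<phi> \<in> separable_maps"
    have pt: "ennreal ((dist (\<phi> w) x\<^sub>0)\<^sup>2) \<le> ennreal (2 * R\<^sup>2 * A) * inner_energy \<phi> w + ennreal (2 * R\<^sup>2)"
      if "w \<in> \<Omega>" for w
    proof -
      let ?D = "displacement act S (\<phi> w)"
      have "(dist (\<phi> w) x\<^sub>0)\<^sup>2 \<le> (R * (1 + ?D))\<^sup>2" by (intro power_mono R) auto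
      also have "\<dots> = R\<^sup>2 * (2 + 2 * ?D\<^sup>2 - (1 - ?D)\<^sup>2)"
        by (simp add: power_mult_distrib) (simp add: power2_eq_square algebra_simps)
      also have "\<dots> \<le> R\<^sup>2 * (2 + 2 * ?D\<^sup>2)" by (intro mult_left_mono) auto
      also have "\<dots> = (2 * R\<^sup>2) * ?D\<^sup>2 + 2 * R\<^sup>2" by (simp add: algebra_simps)
      finally have "ennreal ((dist (\<phi> w) x\<^sub>0)\<^sup>2) \<le> ennreal ((2 * R\<^sup>2) * ?D\<^sup>2 + 2 * R\<^sup>2)" by (rule ennreal_leI)
      also have "\<dots> = ennreal (2 * R\<^sup>2) * ennreal (?D\<^sup>2) + ennreal (2 * R\<^sup>2)"
        by (subst ennreal_plus) (simp_all add: ennreal_mult)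
      also have "\<dots> \<le> ennreal (2 * R\<^sup>2) * (ennreal A * inner_energy \<phi> w) + ennreal (2 * R\<^sup>2)"
        by (intro add_mono mult_left_mono A \<phi> that order_refl) simp
      also have "ennreal (2 * R\<^sup>2) * (ennreal A * inner_energy \<phi> w) = ennreal (2 * R\<^sup>2 * A) * inner_energy \<phi> w"
        using A(1) by (subst ennreal_mult) (simp_all add: mult.assoc)
      finally show ?thesis .
    qed
    note meas = set_integral_measurable[OF inner_energy_measurable[OF \<phi>]]
    have ind: "(\<lambda>w. ennreal (2 * R\<^sup>2) * indicator \<Omega> w) \<in> borel_measurable \<mu>" by measurable
    have "sq_norm \<phi> \<le> (\<integral>\<^sup>+w. ennreal (2 * R\<^sup>2 * A) * (inner_energy \<phi> w * indicator \<Omega> w)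
        + ennreal (2 * R\<^sup>2) * indicator \<Omega> w \<partial>\<mu>)"
      unfolding sq_norm_def by (intro nn_integral_mono) (use pt in \<open>auto simp: indicator_def\<close>)
    also have "\<dots> = (\<integral>\<^sup>+w. ennreal (2 * R\<^sup>2 * A) * (inner_energy \<phi> w * indicator \<Omega> w) \<partial>\<mu>)
        + (\<integral>\<^sup>+w. ennreal (2 * R\<^sup>2) * indicator \<Omega> w \<partial>\<mu>)"
      by (intro nn_integral_add borel_measurable_times_ennreal borel_measurable_const meas ind)
    also have "\<dots> = ennreal (2 * R\<^sup>2 * A) * total_energy \<phi> + ennreal (2 * R\<^sup>2 * measure \<mu> \<Omega>)"
      unfolding total_energy_def using meas
      by (subst nn_integral_cmult, simp, subst nn_integral_cmult_indicator) (simp_all add: sets_\<mu> m ennreal_mult)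
    finally show "sq_norm \<phi> \<le> ennreal (2 * R\<^sup>2 * A) * total_energy \<phi> + ennreal (2 * R\<^sup>2 * measure \<mu> \<Omega>)" .
  qed
qed

section \<open>Existence of minimizers\<close>

definition sq_dist :: "('g \<Rightarrow> 'x) \<Rightarrow> ('g \<Rightarrow> 'x) \<Rightarrow> ennreal" where
  "sq_dist \<phi> \<psi> = (\<integral>\<^sup>+w\<in>\<Omega>. ennreal ((dist (\<phi> w) (\<psi> w))\<^sup>2) \<partial>\<mu>)"

lemma sq_dist_measurable:
  assumes "\<phi> \<in> separable_maps" "\<psi> \<in> borel_measurable borel"
  shows "(\<lambda>w. ennreal ((dist (\<phi> w) (\<psi> w))\<^sup>2) * indicator \<Omega> w) \<in> borel_measurable \<mu>"
proof -
  note measurable_dist[OF assms, measurable]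
  show ?thesis by measurable
qed

text \<open>This is the integrated form of the pointwise defect inequality: the space of square
  integrable equivariant maps is uniformly convex as seen from the orbit map, which is constant on \<open>\<Omega>\<close>.\<close>

lemma sq_dist_mid_le:
  assumes "\<epsilon> > 0"
  obtains C where "C \<ge> 0" "\<And>\<phi> \<psi>. \<phi> \<in> separable_maps \<Longrightarrow> \<psi> \<in> separable_maps \<Longrightarrow>
    sq_dist \<phi> \<psi> + ennreal C * sq_norm (mid_map \<phi> \<psi>) \<le> ennreal (\<epsilon>\<^sup>2 + C / 2) * (sq_norm \<phi> + sq_norm \<psi>)"
proof -
  obtain C where C: "C \<ge> 0"
    "\<And>p x y :: 'x. (dist x y)\<^sup>2 + C * (dist p (geo_midpoint x y))\<^sup>2
       \<le> \<epsilon>\<^sup>2 * ((dist p x)\<^sup>2 + (dist p y)\<^sup>2) + C * (((dist p x)\<^sup>2 + (dist p y)\<^sup>2) / 2)"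
    using uniformly_convex_square_defect[OF bnpc uconv assms] by blast
  show ?thesis
  proof (rule that[OF C(1)])
    fix \<phi> \<psi> assume \<phi>: "\<phi> \<in> separable_maps" and \<psi>: "\<psi> \<in> separable_maps"
    have norm_meas: "(\<lambda>w. ennreal ((dist (\<theta> w) x\<^sub>0)\<^sup>2) * indicator \<Omega> w) \<in> borel_measurable \<mu>"
      if "\<theta> \<in> separable_maps" for \<theta>
      by (rule sq_dist_measurable[OF that]) simp
    note meas = norm_meas[OF \<phi>] norm_meas[OF \<psi>] norm_meas[OF mid_map_separable[OF \<phi> \<psi>]]
      sq_dist_measurable[OF \<phi> separable_maps_measurable[OF \<psi>]]
    let ?c = "\<epsilon>\<^sup>2 + C / 2"
    let ?N = "\<lambda>\<theta> w. ennreal ((dist (\<theta> w) x\<^sub>0)\<^sup>2) * indicator \<Omega> w"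
    have pt: "ennreal ((dist (\<phi> w) (\<psi> w))\<^sup>2) + ennreal C * ennreal ((dist (mid_map \<phi> \<psi> w) x\<^sub>0)\<^sup>2)
      \<le> ennreal ?c * (ennreal ((dist (\<phi> w) x\<^sub>0)\<^sup>2) + ennreal ((dist (\<psi> w) x\<^sub>0)\<^sup>2))" for w
    proof -
      have "(dist (\<phi> w) (\<psi> w))\<^sup>2 + C * (dist (mid_map \<phi> \<psi> w) x\<^sub>0)\<^sup>2
          \<le> ?c * ((dist (\<phi> w) x\<^sub>0)\<^sup>2 + (dist (\<psi> w) x\<^sub>0)\<^sup>2)"
        using C(2)[of "\<phi> w" "\<psi> w" x\<^sub>0] by (simp add: mid_map_def dist_commute[of x\<^sub>0] algebra_simps add_divide_distrib)
      then have "ennreal ((dist (\<phi> w) (\<psi> w))\<^sup>2 + C * (dist (mid_map \<phi> \<psi> w) x\<^sub>0)\<^sup>2)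
          \<le> ennreal (?c * ((dist (\<phi> w) x\<^sub>0)\<^sup>2 + (dist (\<psi> w) x\<^sub>0)\<^sup>2))" by (rule ennreal_leI)
      then show ?thesis using C(1) by (simp add: ennreal_plus ennreal_mult del: ennreal_plus[symmetric])
    qed
    have "sq_dist \<phi> \<psi> + ennreal C * sq_norm (mid_map \<phi> \<psi>)
        = (\<integral>\<^sup>+w. ennreal ((dist (\<phi> w) (\<psi> w))\<^sup>2) * indicator \<Omega> w + ennreal C * ?N (mid_map \<phi> \<psi>) w \<partial>\<mu>)"
      unfolding sq_dist_def sq_norm_def
      by (subst nn_integral_add; (intro borel_measurable_times_ennreal borel_measurable_const meas)?)
         (subst nn_integral_cmult; (intro meas refl)?)
    also have "\<dots> \<le> (\<integral>\<^sup>+w. ennreal ?c * (?N \<phi> w + ?N \<psi> w) \<partial>\<mu>)"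
      by (intro nn_integral_mono) (use pt in \<open>auto simp: indicator_def\<close>)
    also have "\<dots> = ennreal ?c * (\<integral>\<^sup>+w. ?N \<phi> w + ?N \<psi> w \<partial>\<mu>)"
      by (intro nn_integral_cmult borel_measurable_add meas)
    also have "(\<integral>\<^sup>+w. ?N \<phi> w + ?N \<psi> w \<partial>\<mu>) = sq_norm \<phi> + sq_norm \<psi>"
      unfolding sq_norm_def by (intro nn_integral_add meas)
    finally show "sq_dist \<phi> \<psi> + ennreal C * sq_norm (mid_map \<phi> \<psi>) \<le> ennreal ?c * (sq_norm \<phi> + sq_norm \<psi>)" .
  qed
qed

lemma inner_energy_le_liminf:
  assumes "\<And>k. v k \<in> separable_maps" "\<And>g. (\<lambda>k. v k g) \<longlonglongrightarrow> \<phi> g"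
  shows "inner_energy \<phi> w \<le> liminf (\<lambda>k. inner_energy (v k) w)"
proof -
  let ?F = "\<lambda>\<theta> g. energy_weight K (- w + g) * (dist (\<theta> w) (\<theta> g))\<^sup>2"
  have "(\<lambda>k. ennreal (?F (v k) g)) \<longlonglongrightarrow> ennreal (?F \<phi> g)" for g
    by (intro tendsto_ennrealI tendsto_intros assms(2))
  then have "ennreal (?F \<phi> g) = liminf (\<lambda>k. ennreal (?F (v k) g))" for g
    by (rule lim_imp_Liminf[OF sequentially_bot, symmetric])
  then have "inner_energy \<phi> w = (\<integral>\<^sup>+g. liminf (\<lambda>k. ennreal (?F (v k) g)) \<partial>\<mu>)"
    unfolding inner_energy_def by (intro nn_integral_cong)
  also have "\<dots> \<le> liminf (\<lambda>k. inner_energy (v k) w)"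
    unfolding inner_energy_def
    by (intro nn_integral_liminf integrand_measurable separable_maps_measurable assms)
  finally show ?thesis .
qed

lemma total_energy_le_liminf:
  assumes "\<And>k. v k \<in> separable_maps" "\<And>g. (\<lambda>k. v k g) \<longlonglongrightarrow> \<phi> g"
  shows "total_energy \<phi> \<le> liminf (\<lambda>k. total_energy (v k))"
proof -
  have "total_energy \<phi> \<le> (\<integral>\<^sup>+w. liminf (\<lambda>k. inner_energy (v k) w * indicator \<Omega> w) \<partial>\<mu>)"
    unfolding total_energy_def
  proof (intro nn_integral_mono)
    fix w
    show "inner_energy \<phi> w * indicator \<Omega> w \<le> liminf (\<lambda>k. inner_energy (v k) w * indicator \<Omega> w)"
      using inner_energy_le_liminf[OF assms, of w] by (cases "w \<in> \<Omega>") simp_all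
  qed
  also have "\<dots> \<le> liminf (\<lambda>k. total_energy (v k))"
    unfolding total_energy_def
    by (intro nn_integral_liminf set_integral_measurable inner_energy_measurable assms)
  finally show ?thesis .
qed

text \<open>The set where the maps converge geometrically fast is invariant under \<open>\<Gamma>\<close>, so it has full
  measure in the group once it has full measure in \<open>\<Omega>\<close>. Off this set all maps are replaced by the
  orbit map, which keeps the limit equivariant.\<close>

lemma fast_Cauchy_limit:
  assumes u: "\<And>k. u k \<in> separable_maps"
    and fast: "\<And>k. sq_dist (u k) (u (Suc k)) \<le> ennreal ((1/8) ^ k)"
  obtains \<phi> where "\<phi> \<in> separable_maps" "total_energy \<phi> \<le> liminf (\<lambda>k. total_energy (u k))"
proof -
  let ?d = "\<lambda>k g. (dist (u k g) (u (Suc k) g))\<^sup>2"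
  \<comment> \<open>The weights \<open>4 ^ k\<close> keep the series summable against \<open>(1/8) ^ k\<close>, and where it is finite they
    force steps of size \<open>O((1/2) ^ k)\<close>.\<close>
  define T where "T g = (\<Sum>k. ennreal (4 ^ k) * ennreal (?d k g))" for g
  note measurable_dist[OF u separable_maps_measurable[OF u], measurable]
  have T_meas[measurable]: "T \<in> borel_measurable borel" unfolding T_def[abs_def] by measurable
  define A where "A = {g. T g \<noteq> \<infinity>}"
  have A[measurable]: "A \<in> sets borel" unfolding A_def by measurable
  have inv: "\<gamma> + g \<in> A \<longleftrightarrow> g \<in> A" if "\<gamma> \<in> \<Gamma>" for \<gamma> g
    using that separable_maps_equivariant[OF u]
    by (simp add: A_def T_def equivariant_dist)
  have "(\<integral>\<^sup>+w. T w * indicator \<Omega> w \<partial>\<mu>) = (\<integral>\<^sup>+w. (\<Sum>k. ennreal (4 ^ k) * (ennreal (?d k w) * indicator \<Omega> w)) \<partial>\<mu>)"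
    unfolding T_def by (simp add: mult.assoc flip: ennreal_suminf_multc)
  also have "\<dots> = (\<Sum>k. \<integral>\<^sup>+w. ennreal (4 ^ k) * (ennreal (?d k w) * indicator \<Omega> w) \<partial>\<mu>)"
    by (rule nn_integral_suminf) measurable
  also have "\<dots> = (\<Sum>k. ennreal (4 ^ k) * sq_dist (u k) (u (Suc k)))"
    unfolding sq_dist_def
    by (intro suminf_cong nn_integral_cmult sq_dist_measurable separable_maps_measurable u)
  also have "\<dots> \<le> (\<Sum>k. ennreal ((1/2) ^ k))"
  proof (intro suminf_le summableI)
    fix k
    have "ennreal (4 ^ k) * sq_dist (u k) (u (Suc k)) \<le> ennreal (4 ^ k) * ennreal ((1/8) ^ k)"
      by (intro mult_left_mono fast) simp
    also have "\<dots> = ennreal ((1/2) ^ k)"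
      by (subst ennreal_mult[symmetric]) (simp_all flip: power_mult_distrib)
    finally show "ennreal (4 ^ k) * sq_dist (u k) (u (Suc k)) \<le> ennreal ((1/2) ^ k)" .
  qed
  also have "\<dots> = ennreal (\<Sum>k. (1/2) ^ k)"
    by (intro suminf_ennreal2 summable_geometric) auto
  also have "\<dots> < \<infinity>" by simp
  finally have "(\<integral>\<^sup>+w. T w * indicator \<Omega> w \<partial>\<mu>) \<noteq> \<infinity>" by simp
  then have "AE w in \<mu>. T w * indicator \<Omega> w \<noteq> \<infinity>"
    by (intro nn_integral_PInf_AE set_integral_measurable T_meas)
  then have AE_\<Omega>: "AE w in \<mu>. w \<in> \<Omega> \<longrightarrow> w \<in> A" by (auto simp: A_def elim!: eventually_mono)
  have AE_A: "AE g in \<mu>. g \<in> A" by (rule AE_from_fundamental_domain[OF A _ AE_\<Omega>]) (rule inv)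
  have Cauchy: "Cauchy (\<lambda>k. u k g)" if gA: "g \<in> A" for g
  proof -
    obtain t where t: "T g = ennreal t" "t \<ge> 0" using gA by (cases "T g") (auto simp: A_def)
    show ?thesis
    proof (rule geometric_steps_Cauchy)
      fix k
      have "ennreal (4 ^ k * ?d k g) = ennreal (4 ^ k) * ennreal (?d k g)" by (simp add: ennreal_mult)
      also have "\<dots> \<le> T g" unfolding T_def using sum_le_suminf[OF summableI, of "{k}" "\<lambda>k. ennreal (4 ^ k) * ennreal (?d k g)"] by simp
      finally have "4 ^ k * ?d k g \<le> t" using t by simp
      then have "(2 ^ k * dist (u k g) (u (Suc k) g))\<^sup>2 \<le> t"
        using power_mult[of "2::real" 2 k] power_mult[of "2::real" k 2]
        by (simp add: power_mult_distrib mult.commute[of k])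
      then have "2 ^ k * dist (u k g) (u (Suc k) g) \<le> sqrt t" by (rule real_le_rsqrt)
      then show "dist (u k g) (u (Suc k) g) \<le> sqrt t * (1/2) ^ k"
        by (simp add: power_divide field_simps)
    qed
  qed
  define v where "v k g = (if g \<in> A then u k g else orbit_map g)" for k g
  define \<phi> where "\<phi> g = lim (\<lambda>k. v k g)" for g
  have v: "v k \<in> separable_maps" for k
  proof -
    obtain D where D: "countable D" "range (u k) \<subseteq> closure D"
      using u[of k] unfolding separable_maps_def by blast
    show ?thesis unfolding v_def[abs_def]
    proof (rule modification_separable[OF separable_maps_measurable[OF u] separable_maps_equivariant[OF u] A])
      show "\<gamma> + g \<in> A \<longleftrightarrow> g \<in> A" if "\<gamma> \<in> \<Gamma>" for \<gamma> g using that by (rule inv)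
      show "countable D" by (rule D(1))
      show "u k g \<in> closure D" for g using D(2) by blast
    qed
  qed
  have conv: "(\<lambda>k. v k g) \<longlonglongrightarrow> \<phi> g" for g
  proof -
    have "convergent (\<lambda>k. v k g)"
      using Cauchy[of g] by (cases "g \<in> A") (simp_all add: v_def Cauchy_convergent_iff convergent_const)
    then show ?thesis unfolding \<phi>_def by (rule convergent_LIMSEQ_iff[THEN iffD1])
  qed
  have "\<exists>E. countable E \<and> range (v k) \<subseteq> closure E" for k
    using v[of k] unfolding separable_maps_def by blast
  then obtain E where E: "\<And>k. countable (E k) \<and> range (v k) \<subseteq> closure (E k)" by metis
  have "\<phi> \<in> separable_maps"
    unfolding separable_maps_def
  proof (intro CollectI conjI exI)
    show "\<phi> \<in> borel_measurable borel"
      by (rule borel_measurable_LIMSEQ_metric[OF separable_maps_measurable[OF v] conv])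
    show "equivariant \<phi>"
      unfolding equivariant_def
    proof (intro ballI allI)
      fix \<gamma> g assume \<gamma>: "\<gamma> \<in> \<Gamma>"
      have "(\<lambda>k. act \<gamma> (v k g)) \<longlonglongrightarrow> act \<gamma> (\<phi> g)"
        by (rule continuous_on_tendsto_compose[OF continuous_act[OF \<gamma>, of UNIV] conv]) auto
      moreover have "act \<gamma> (v k g) = v k (\<gamma> + g)" for k
        using separable_maps_equivariant[OF v] \<gamma> by (simp add: equivariant_def)
      ultimately have "(\<lambda>k. v k (\<gamma> + g)) \<longlonglongrightarrow> act \<gamma> (\<phi> g)" by simp
      then show "\<phi> (\<gamma> + g) = act \<gamma> (\<phi> g)" using conv by (rule LIMSEQ_unique[rotated])
    qed
    show "countable (\<Union>k. E k)" using E by simp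
    show "range \<phi> \<subseteq> closure (\<Union>k. E k)"
    proof safe
      fix g
      have "v k g \<in> closure (\<Union>k. E k)" for k
        using E[of k] closure_mono[of "E k" "\<Union>k. E k"] by blast
      then show "\<phi> g \<in> closure (\<Union>k. E k)" using closed_sequentially[OF closed_closure _ conv] by blast
    qed
  qed
  moreover have "total_energy (v k) = total_energy (u k)" for k
    by (rule total_energy_cong_AE) (use AE_A in \<open>auto simp: v_def elim!: eventually_mono\<close>)
  then have "total_energy \<phi> \<le> liminf (\<lambda>k. total_energy (u k))"
    using total_energy_le_liminf[OF v conv] by simp
  ultimately show ?thesis by (rule that)
qed

text \<open>For the minimizing sequence of the two-stage minimization, with \<open>J\<close> the energy and \<open>N\<close> the
  squared norm, uniform convexity turns the small defect of \<open>N\<close> at midpoints into the Cauchy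
  property for the squared distance. A fast subsequence has a limit, and Fatou's lemma bounds its
  energy by the infimum.\<close>

lemma total_energy_minimizer:
  assumes "\<exists>\<phi>\<in>separable_maps. total_energy \<phi> < \<infinity>"
  obtains \<phi> where "\<phi> \<in> separable_maps" "total_energy \<phi> < \<infinity>"
    "\<And>\<psi>. \<psi> \<in> separable_maps \<Longrightarrow> total_energy \<phi> \<le> total_energy \<psi>"
proof -
  define S where "S = {\<phi> \<in> separable_maps. total_energy \<phi> < \<infinity>}"
  define J where "J \<phi> = enn2real (total_energy \<phi>)" for \<phi>
  define N where "N \<phi> = enn2real (sq_norm \<phi>)" for \<phi>
  obtain A B where AB: "A \<ge> 0" "B \<ge> 0"
    "\<And>\<phi>. \<phi> \<in> separable_maps \<Longrightarrow> sq_norm \<phi> \<le> ennreal A * total_energy \<phi> + ennreal B"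
    using sq_norm_le_total_energy by blast
  have J: "total_energy \<phi> = ennreal (J \<phi>)" if "\<phi> \<in> S" for \<phi>
    using that by (simp add: J_def S_def)
  have J0: "0 \<le> J \<phi>" and N0: "0 \<le> N \<phi>" for \<phi> by (simp_all add: J_def N_def)
  have sq_le: "sq_norm \<phi> \<le> ennreal (A * J \<phi> + B)" if "\<phi> \<in> S" for \<phi>
  proof -
    have "sq_norm \<phi> \<le> ennreal A * ennreal (J \<phi>) + ennreal B"
      using AB(3)[of \<phi>] J[OF that] that by (simp add: S_def)
    also have "\<dots> = ennreal (A * J \<phi> + B)"
      using AB J0 by (simp add: ennreal_mult ennreal_plus)
    finally show ?thesis .
  qed
  have N: "sq_norm \<phi> = ennreal (N \<phi>)" if "\<phi> \<in> S" for \<phi>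
    using order.strict_trans1[OF sq_le[OF that] ennreal_less_top] by (simp add: N_def)
  have coercive: "N \<phi> \<le> A * J \<phi> + B" if "\<phi> \<in> S" for \<phi>
  proof -
    have "ennreal (N \<phi>) \<le> ennreal (A * J \<phi> + B)" using sq_le[OF that] unfolding N[OF that] .
    then show ?thesis using AB J0 by (subst (asm) ennreal_le_iff) auto
  qed
  have mid: "mid_map \<phi> \<psi> \<in> S \<and> J (mid_map \<phi> \<psi>) \<le> (J \<phi> + J \<psi>) / 2" if "\<phi> \<in> S" "\<psi> \<in> S" for \<phi> \<psi>
  proof -
    have sep: "\<phi> \<in> separable_maps" "\<psi> \<in> separable_maps" using that by (auto simp: S_def)
    have le: "2 * total_energy (mid_map \<phi> \<psi>) \<le> ennreal (J \<phi> + J \<psi>)"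
      using total_energy_mid_le[OF sep] J that J0 by (simp add: ennreal_plus)
    then have "2 * total_energy (mid_map \<phi> \<psi>) < \<infinity>" by (rule order.strict_trans1) simp
    then have mS: "mid_map \<phi> \<psi> \<in> S"
      using mid_map_separable[OF sep] by (auto simp: S_def ennreal_mult_less_top)
    have "ennreal (2 * J (mid_map \<phi> \<psi>)) = 2 * ennreal (J (mid_map \<phi> \<psi>))"
      using J0 by (subst ennreal_mult) simp_all
    also have "\<dots> \<le> ennreal (J \<phi> + J \<psi>)" using le J[OF mS] by simp
    finally have "2 * J (mid_map \<phi> \<psi>) \<le> J \<phi> + J \<psi>"
      using J0 by (subst (asm) ennreal_le_iff) (intro add_nonneg_nonneg)
    with mS show ?thesis by simp
  qed
  have "S \<noteq> {}" using assms by (auto simp: S_def)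
  define a where "a = Inf (J ` S)"
  obtain s where s: "\<And>n::nat. s n \<in> S" "\<And>n. J (s n) \<le> a + 1 / Suc n"
    and defect: "\<And>\<eta>. \<eta> > 0 \<Longrightarrow> \<exists>M. \<forall>m\<ge>M. \<forall>n\<ge>M. (N (s m) + N (s n)) / 2 - N (mid_map (s m) (s n)) < \<eta>"
    using minimizing_sequence_small_defect[OF \<open>S \<noteq> {}\<close> J0 N0 mid coercive AB(1)] unfolding a_def by blast
  have s_sep: "s n \<in> separable_maps" for n using s(1)[of n] by (simp add: S_def)
  have bdd: "bdd_below (J ` S)" using J0 by (intro bdd_belowI[of _ 0]) auto
  have a_le: "a \<le> J \<phi>" if "\<phi> \<in> S" for \<phi> unfolding a_def using that bdd by (intro cInf_lower) auto
  have a0: "0 \<le> a" unfolding a_def using \<open>S \<noteq> {}\<close> J0 by (intro cInf_greatest) auto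
  define b where "b = A * (a + 1) + B"
  have b0: "0 \<le> b" unfolding b_def using AB a0 by simp
  have N_le: "N (s n) \<le> b" for n
  proof -
    have "J (s n) \<le> a + 1" using s(2)[of n] by (rule order_trans) simp
    then have "A * J (s n) \<le> A * (a + 1)" using AB(1) by (rule mult_left_mono)
    with coercive[OF s(1), of n] show ?thesis unfolding b_def by linarith
  qed
  have Cauchy: "\<exists>M. \<forall>m\<ge>M. \<forall>n\<ge>M. sq_dist (s m) (s n) \<le> ennreal \<delta>" if "\<delta> > 0" for \<delta>
  proof -
    \<comment> \<open>With this \<open>\<epsilon>\<close> the error term \<open>\<epsilon>\<^sup>2 * (N (s m) + N (s n))\<close> is at most \<open>\<delta> / 2\<close>; below, \<open>\<eta>\<close>
      makes \<open>C\<close> times the defect at most \<open>\<delta> / 2\<close>.\<close>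
    define \<epsilon> where "\<epsilon> = sqrt (\<delta> / (4 * (b + 1)))"
    have \<epsilon>: "\<epsilon> > 0" "\<epsilon>\<^sup>2 = \<delta> / (4 * (b + 1))" using that b0 by (simp_all add: \<epsilon>_def)
    obtain C where C: "C \<ge> 0" "\<And>\<phi> \<psi>. \<phi> \<in> separable_maps \<Longrightarrow> \<psi> \<in> separable_maps \<Longrightarrow>
      sq_dist \<phi> \<psi> + ennreal C * sq_norm (mid_map \<phi> \<psi>) \<le> ennreal (\<epsilon>\<^sup>2 + C / 2) * (sq_norm \<phi> + sq_norm \<psi>)"
      using sq_dist_mid_le[OF \<epsilon>(1)] by blast
    define \<eta> where "\<eta> = \<delta> / 2 / (C + 1)"
    have \<eta>: "\<eta> > 0" using that C(1) by (simp add: \<eta>_def)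
    obtain M where M: "\<And>m n. m \<ge> M \<Longrightarrow> n \<ge> M \<Longrightarrow> (N (s m) + N (s n)) / 2 - N (mid_map (s m) (s n)) < \<eta>"
      using defect[OF \<eta>] by blast
    have "sq_dist (s m) (s n) \<le> ennreal \<delta>" if "m \<ge> M" "n \<ge> M" for m n
    proof -
      let ?n = "N (s m) + N (s n)" and ?p = "N (mid_map (s m) (s n))"
      have c0: "0 \<le> \<epsilon>\<^sup>2 + C / 2" using C(1) by simp
      have "sq_dist (s m) (s n) + ennreal C * ennreal ?p
          \<le> ennreal (\<epsilon>\<^sup>2 + C / 2) * (ennreal (N (s m)) + ennreal (N (s n)))"
        using C(2)[OF s_sep s_sep, of m n] N s(1) mid[OF s(1) s(1), of m n] by simp
      also have "\<dots> = ennreal ((\<epsilon>\<^sup>2 + C / 2) * ?n)"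
        using N0 c0 by (simp add: ennreal_mult ennreal_plus)
      finally have le: "sq_dist (s m) (s n) + ennreal (C * ?p) \<le> ennreal ((\<epsilon>\<^sup>2 + C / 2) * ?n)"
        using C(1) N0 by (simp add: ennreal_mult)
      have "sq_dist (s m) (s n) \<le> sq_dist (s m) (s n) + ennreal (C * ?p)" by simp
      also note le
      also have "ennreal ((\<epsilon>\<^sup>2 + C / 2) * ?n) < \<infinity>" by simp
      finally obtain r where r: "sq_dist (s m) (s n) = ennreal r" "r \<ge> 0"
        by (cases "sq_dist (s m) (s n)") auto
      have "ennreal (r + C * ?p) \<le> ennreal ((\<epsilon>\<^sup>2 + C / 2) * ?n)"
        using le r C(1) N0 by (simp add: ennreal_plus)
      moreover have "0 \<le> (\<epsilon>\<^sup>2 + C / 2) * ?n" using c0 N0 by simp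
      ultimately have "r + C * ?p \<le> (\<epsilon>\<^sup>2 + C / 2) * ?n" by (simp add: ennreal_le_iff)
      then have "r \<le> \<epsilon>\<^sup>2 * ?n + C * (?n / 2 - ?p)" by (simp add: algebra_simps add_divide_distrib)
      also have "\<dots> \<le> \<delta> / 2 + \<delta> / 2"
      proof (rule add_mono)
        have "?n \<le> 2 * (b + 1)" using N_le[of m] N_le[of n] by simp
        then have "\<epsilon>\<^sup>2 * ?n \<le> \<epsilon>\<^sup>2 * (2 * (b + 1))" by (intro mult_left_mono) auto
        also have "\<dots> = \<delta> / 2" using b0 by (simp add: \<epsilon>(2) field_simps)
        finally show "\<epsilon>\<^sup>2 * ?n \<le> \<delta> / 2" .
        have "C * (?n / 2 - ?p) \<le> C * \<eta>" using M[OF that] C(1) by (intro mult_left_mono) auto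
        also have "\<dots> \<le> (C + 1) * \<eta>" using \<eta> by (intro mult_right_mono) auto
        also have "(C + 1) * \<eta> = \<delta> / 2" using C(1) by (simp add: \<eta>_def field_simps)
        finally show "C * (?n / 2 - ?p) \<le> \<delta> / 2" .
      qed
      finally show ?thesis unfolding r(1) by (intro ennreal_leI) simp
    qed
    then show ?thesis by blast
  qed
  have "\<exists>M. \<forall>k. \<forall>m\<ge>M k. \<forall>n\<ge>M k. sq_dist (s m) (s n) \<le> ennreal ((1/8) ^ k)"
    by (intro choice allI Cauchy) simp
  then obtain M where M: "\<And>k m n. m \<ge> M k \<Longrightarrow> n \<ge> M k \<Longrightarrow> sq_dist (s m) (s n) \<le> ennreal ((1/8) ^ k)"
    by blast
  \<comment> \<open>The sum makes \<open>r\<close> monotone, so that \<open>r (Suc k)\<close> is also at least \<open>M k\<close>. The summand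
    \<open>k\<close> makes the energies along \<open>r\<close> tend to the infimum.\<close>
  define r where "r k = k + sum M {..k}" for k
  have r_ge: "r k \<ge> M k" "r (Suc k) \<ge> M k" "r k \<ge> k" for k
    using member_le_sum[of k "{..k}" M] by (auto simp: r_def)
  obtain \<phi> where \<phi>: "\<phi> \<in> separable_maps" "total_energy \<phi> \<le> liminf (\<lambda>k. total_energy (s (r k)))"
  proof (rule fast_Cauchy_limit[of "\<lambda>k. s (r k)"])
    show "sq_dist (s (r k)) (s (r (Suc k))) \<le> ennreal ((1/8) ^ k)" for k by (intro M r_ge)
  qed (use s_sep in auto)
  have "liminf (\<lambda>k. total_energy (s (r k))) \<le> liminf (\<lambda>k. ennreal (a + 1 / Suc k))"
  proof (intro Liminf_mono always_eventually allI)
    fix k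
    have "J (s (r k)) \<le> a + 1 / Suc (r k)" by (rule s(2))
    also have "1 / real (Suc (r k)) \<le> 1 / Suc k" using r_ge(3)[of k] by (intro divide_left_mono) auto
    finally show "total_energy (s (r k)) \<le> ennreal (a + 1 / Suc k)"
      unfolding J[OF s(1)] by (intro ennreal_leI) simp
  qed
  also have "\<dots> = ennreal a"
  proof (rule lim_imp_Liminf[OF sequentially_bot])
    have "(\<lambda>k. a + 1 / Suc k) \<longlonglongrightarrow> a + 0"
      using LIMSEQ_inverse_real_of_nat by (intro tendsto_add tendsto_const) (simp add: inverse_eq_divide)
    then show "(\<lambda>k. ennreal (a + 1 / Suc k)) \<longlonglongrightarrow> ennreal a" by (intro tendsto_ennrealI) simp
  qed
  finally have le_a: "total_energy \<phi> \<le> ennreal a" using \<phi>(2) by (rule order_trans[rotated])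
  show ?thesis
  proof (rule that[OF \<phi>(1)])
    show "total_energy \<phi> < \<infinity>" using le_a by (rule order.strict_trans1) simp
    fix \<psi> assume \<psi>: "\<psi> \<in> separable_maps"
    show "total_energy \<phi> \<le> total_energy \<psi>"
    proof (cases "total_energy \<psi> < \<infinity>")
      case True
      with \<psi> have "\<psi> \<in> S" by (simp add: S_def)
      have "total_energy \<phi> \<le> ennreal a" by (rule le_a)
      also have "\<dots> \<le> total_energy \<psi>" unfolding J[OF \<open>\<psi> \<in> S\<close>] by (intro ennreal_leI a_le \<open>\<psi> \<in> S\<close>)
      finally show ?thesis .
    qed (simp add: less_top[symmetric])
  qed
qed

lemma separable_map_in_L2:
  assumes \<phi>: "\<phi> \<in> separable_maps" and "sq_norm \<phi> < \<infinity>"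
  shows "\<phi> \<in> L2_equivariant act \<Gamma> \<mu> \<Omega> x\<^sub>0"
proof -
  obtain D where D: "countable D" "range \<phi> \<subseteq> closure D" using \<phi> by (auto simp: separable_maps_def)
  then have "countable D \<and> (AE g in \<mu>. \<phi> g \<in> closure D)" by auto
  moreover have "\<phi> \<in> borel_measurable \<mu>"
    using separable_maps_measurable[OF \<phi>] by (simp add: measurable_cong_sets[OF sets_\<mu> refl])
  ultimately show ?thesis
    using assms(2) separable_maps_equivariant[OF \<phi>]
    unfolding L2_equivariant_def sq_norm_def equivariant_def by blast
qed

text \<open>If no map has finite energy, every square integrable equivariant map is a minimizer, and the
  orbit map belongs to this class.\<close>

theorem harmonic_map_exists: "\<exists>\<phi>. harmonic_map act K \<Gamma> \<mu> \<Omega> x\<^sub>0 \<phi>"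
proof (cases "\<exists>\<phi>\<in>separable_maps. total_energy \<phi> < \<infinity>")
  case True
  then obtain \<phi> where \<phi>: "\<phi> \<in> separable_maps" "total_energy \<phi> < \<infinity>"
    and min: "\<And>\<psi>. \<psi> \<in> separable_maps \<Longrightarrow> total_energy \<phi> \<le> total_energy \<psi>"
    using total_energy_minimizer by blast
  obtain A B where "sq_norm \<phi> \<le> ennreal A * total_energy \<phi> + ennreal B"
    using sq_norm_le_total_energy \<phi>(1) by metis
  also have "\<dots> < \<infinity>" using \<phi>(2) by (simp add: ennreal_mult_less_top)
  finally have "\<phi> \<in> L2_equivariant act \<Gamma> \<mu> \<Omega> x\<^sub>0" by (rule separable_map_in_L2[OF \<phi>(1)])
  moreover have "energy K \<mu> \<Omega> \<phi> \<le> energy K \<mu> \<Omega> \<psi>" if \<psi>: "\<psi> \<in> L2_equivariant act \<Gamma> \<mu> \<Omega> x\<^sub>0" for \<psi>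
  proof -
    obtain \<psi>' where \<psi>': "\<psi>' \<in> separable_maps" "AE g in \<mu>. \<psi>' g = \<psi> g"
      using L2_equivalent_separable[OF \<psi>] .
    show ?thesis
      unfolding energy_eq using min[OF \<psi>'(1)] total_energy_cong_AE[OF \<psi>'(2)]
      by (intro divide_right_mono_ennreal) simp
  qed
  ultimately show ?thesis unfolding harmonic_map_def by blast
next
  case False
  have "sq_norm orbit_map = (\<integral>\<^sup>+w. 0 \<partial>\<mu>)"
    unfolding sq_norm_def by (intro nn_integral_cong) (auto simp: indicator_def orbit_map_\<Omega>)
  then have "orbit_map \<in> L2_equivariant act \<Gamma> \<mu> \<Omega> x\<^sub>0"
    by (intro separable_map_in_L2 orbit_map_separable) simp
  moreover have "energy K \<mu> \<Omega> orbit_map \<le> energy K \<mu> \<Omega> \<psi>" if \<psi>: "\<psi> \<in> L2_equivariant act \<Gamma> \<mu> \<Omega> x\<^sub>0" for \<psi>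
  proof -
    obtain \<psi>' where \<psi>': "\<psi>' \<in> separable_maps" "AE g in \<mu>. \<psi>' g = \<psi> g"
      using L2_equivalent_separable[OF \<psi>] .
    then have "total_energy \<psi> = \<infinity>"
      using False total_energy_cong_AE[OF \<psi>'(2)] by (auto simp: less_top[symmetric])
    then show ?thesis unfolding energy_eq by (intro divide_right_mono_ennreal) simp
  qed
  ultimately show ?thesis unfolding harmonic_map_def by blast
qed

end

theorem proposition8p2:
  fixes \<Gamma> \<Lambda> K :: "'g::{topological_group_add,t2_space} set"
    and act :: "'g \<Rightarrow> 'x::complete_space \<Rightarrow> 'x"
    and \<mu> :: "'g measure"
  assumes "locally_compact_space (euclidean :: 'g topology)"
    and "compact_generating_set K"
    and "haar_measure \<mu>"
    and "cocompact_lattice \<Gamma>"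
    and "is_subgroup \<Lambda>" and "\<Gamma> \<subseteq> \<Lambda>" and "\<Lambda> \<subseteq> commensurator \<Gamma>" and "closure \<Lambda> = UNIV"
    and "bnpc TYPE('x)" and "uniformly_convex TYPE('x)"
    and "isometric_action \<Lambda> act"
    and "C_minimal \<Lambda> act"
    and "\<And>\<Delta>. is_subgroup \<Delta> \<Longrightarrow> \<Delta> \<subseteq> \<Lambda> \<Longrightarrow> commensurable \<Delta> \<Gamma> \<Longrightarrow>
           displacement_to_infinity act \<Delta> \<and> no_parallel_orbits act \<Delta>"
  shows "\<forall>\<Gamma>\<^sub>0 \<Omega>\<^sub>0 x\<^sub>0. is_subgroup \<Gamma>\<^sub>0 \<and> \<Gamma>\<^sub>0 \<subseteq> \<Lambda> \<and> commensurable \<Gamma>\<^sub>0 \<Gamma>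
           \<and> rel_compact_fundamental_domain \<Gamma>\<^sub>0 \<Omega>\<^sub>0
         \<longrightarrow> (\<exists>\<phi>. harmonic_map act K \<Gamma>\<^sub>0 \<mu> \<Omega>\<^sub>0 x\<^sub>0 \<phi>)"
proof (intro allI impI, elim conjE)
  fix \<Gamma>\<^sub>0 \<Omega>\<^sub>0 :: "'g set" and x\<^sub>0 :: 'x
  assume \<Gamma>\<^sub>0: "is_subgroup \<Gamma>\<^sub>0" "\<Gamma>\<^sub>0 \<subseteq> \<Lambda>" "commensurable \<Gamma>\<^sub>0 \<Gamma>"
    and \<Omega>\<^sub>0: "rel_compact_fundamental_domain \<Gamma>\<^sub>0 \<Omega>\<^sub>0"
  have displ: "displacement_to_infinity act \<Gamma>\<^sub>0" using assms(13)[OF \<Gamma>\<^sub>0] by (rule conjunct1)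
  then obtain S where "finite S" "is_subgroup hull S = \<Gamma>\<^sub>0"
    unfolding displacement_to_infinity_def by blast
  then have "countable \<Gamma>\<^sub>0" using countable_finitely_generated_subgroup by blast
  moreover have "isometric_action \<Gamma>\<^sub>0 act"
    using assms(11) \<Gamma>\<^sub>0(2) unfolding isometric_action_def by blast
  ultimately interpret equivariant_maps K \<Gamma>\<^sub>0 \<Omega>\<^sub>0 act \<mu> x\<^sub>0
    using assms(1-3,9,10) \<Gamma>\<^sub>0(1) \<Omega>\<^sub>0 displ by unfold_locales
  show "\<exists>\<phi>. harmonic_map act K \<Gamma>\<^sub>0 \<mu> \<Omega>\<^sub>0 x\<^sub>0 \<phi>" by (rule harmonic_map_exists)
qed

end
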